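(* Connected nonabelian nilpotent Lie groups do not admit cyclic left-invariant metrics.
   Context: A left-invariant Riemannian metric on a real Lie group $G$ with Lie algebra $\mathfrak{g}$, with corresponding inner product $\langle\cdot,\cdot\rangle$ on $\mathfrak{g}$, is called cyclic if $\langle [X,Y],Z\rangle+\langle [Y,Z],X\rangle+\langle [Z,X],Y\rangle=0$ for all $X,Y,Z\in\mathfrak{g}$. *)

theory Defs
  imports "HOL-Analysis.Analysis" "HOL-Algebra.Generated_Groups"
begin

section \<open>Smooth maps between open subsets of Euclidean spaces\<close>

text \<open>For an open set \<open>S\<close>, \<open>Ck_on k S f\<close> says that all iterated directional derivatives of \<open>f\<close> of
  order at most \<open>k\<close> exist (as Frechet derivatives) and are continuous on \<open>S\<close>. The predicate is only
  used on open sets.\<close>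

primrec Ck_on ::
  "nat \<Rightarrow> 'a::real_normed_vector set \<Rightarrow> ('a \<Rightarrow> 'b::real_normed_vector) \<Rightarrow> bool" where
  "Ck_on 0 S f \<longleftrightarrow> continuous_on S f"
| "Ck_on (Suc k) S f \<longleftrightarrow>
     (\<forall>x\<in>S. f differentiable (at x)) \<and> (\<forall>v. Ck_on k S (\<lambda>x. frechet_derivative f (at x) v))"

definition smooth_on :: "'a::real_normed_vector set \<Rightarrow> ('a \<Rightarrow> 'b::real_normed_vector) \<Rightarrow> bool" where
  "smooth_on S f \<longleftrightarrow> (\<forall>k. Ck_on k S f)"


section \<open>Smooth manifolds\<close>

text \<open>A chart is a pair of its domain and its coordinate map, the latter being meaningful on the
  domain only. The model space \<open>'e\<close> fixes the dimension, which may be any positive integer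
  (zero-dimensional manifolds, which are discrete, are not covered). An atlas is not required to be maximal; all notions below depend only on the maximal atlas it generates.\<close>

type_synonym ('a, 'e) chart = "'a set \<times> ('a \<Rightarrow> 'e)"

record ('a, 'e) manifold =
  space_of :: "'a topology"
  atlas :: "('a, 'e) chart set"

definition is_chart :: "'a topology \<Rightarrow> ('a, 'e::euclidean_space) chart \<Rightarrow> bool" where
  "is_chart T c \<longleftrightarrow> (case c of (V, \<phi>) \<Rightarrow>
     openin T V \<and> open (\<phi> ` V) \<and>
     homeomorphic_map (subtopology T V) (top_of_set (\<phi> ` V)) \<phi>)"

definition smooth_manifold :: "('a, 'e::euclidean_space) manifold \<Rightarrow> bool" where
  "smooth_manifold M \<longleftrightarrow>
     Hausdorff_space (space_of M) \<and> second_countable (space_of M) \<and>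
     (\<forall>c\<in>atlas M. is_chart (space_of M) c) \<and>
     (\<Union>(V, \<phi>)\<in>atlas M. V) = topspace (space_of M) \<and>
     (\<forall>(V, \<phi>)\<in>atlas M. \<forall>(W, \<psi>)\<in>atlas M. smooth_on (\<phi> ` (V \<inter> W)) (\<psi> \<circ> inv_into V \<phi>))"

definition euclidean_manifold :: "('e, 'e::euclidean_space) manifold" where
  "euclidean_manifold = \<lparr>space_of = euclidean, atlas = {(UNIV, \<lambda>x. x)}\<rparr>"

definition prod_manifold ::
  "('a, 'e::euclidean_space) manifold \<Rightarrow> ('b, 'f::euclidean_space) manifold \<Rightarrow>
   ('a \<times> 'b, 'e \<times> 'f) manifold" where
  "prod_manifold M N =
     \<lparr>space_of = prod_topology (space_of M) (space_of N),
      atlas = {(V \<times> W, map_prod \<phi> \<psi>) | V \<phi> W \<psi>. (V, \<phi>) \<in> atlas M \<and> (W, \<psi>) \<in> atlas N}\<rparr>"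

definition smooth_map_on ::
  "('a, 'e::euclidean_space) manifold \<Rightarrow> ('b, 'f::euclidean_space) manifold \<Rightarrow>
   'a set \<Rightarrow> ('a \<Rightarrow> 'b) \<Rightarrow> bool" where
  "smooth_map_on M N U F \<longleftrightarrow>
     openin (space_of M) U \<and> continuous_map (subtopology (space_of M) U) (space_of N) F \<and>
     (\<forall>(V, \<phi>)\<in>atlas M. \<forall>(W, \<psi>)\<in>atlas N.
        smooth_on (\<phi> ` {p \<in> U \<inter> V. F p \<in> W}) (\<psi> \<circ> F \<circ> inv_into V \<phi>))"

abbreviation smooth_map ::
  "('a, 'e::euclidean_space) manifold \<Rightarrow> ('b, 'f::euclidean_space) manifold \<Rightarrow>
   ('a \<Rightarrow> 'b) \<Rightarrow> bool" where
  "smooth_map M N F \<equiv> smooth_map_on M N (topspace (space_of M)) F"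

definition smooth_at :: "('a, 'e::euclidean_space) manifold \<Rightarrow> 'a \<Rightarrow> ('a \<Rightarrow> real) \<Rightarrow> bool" where
  "smooth_at M p f \<longleftrightarrow> (\<exists>U. p \<in> U \<and> smooth_map_on M euclidean_manifold U f)"


section \<open>Tangent vectors and vector fields\<close>

text \<open>Tangent vectors at \<open>p\<close> are the directional derivative operators along smooth curves through \<open>p\<close>.
  They act on the real functions that are smooth in a neighbourhood of \<open>p\<close>; the value 0 on all other
  functions is a dummy that makes equality of tangent vectors extensional.\<close>

type_synonym 'a tangent_vector = "('a \<Rightarrow> real) \<Rightarrow> real"

definition velocity :: "('a, 'e::euclidean_space) manifold \<Rightarrow> (real \<Rightarrow> 'a) \<Rightarrow> 'a tangent_vector" where
  "velocity M \<gamma> = (\<lambda>f. if smooth_at M (\<gamma> 0) f then deriv (\<lambda>t. f (\<gamma> t)) 0 else 0)"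

definition tangent_space ::
  "('a, 'e::euclidean_space) manifold \<Rightarrow> 'a \<Rightarrow> 'a tangent_vector set" where
  "tangent_space M p =
     {velocity M \<gamma> | \<gamma> \<epsilon>. \<epsilon> > 0 \<and> smooth_map_on euclidean_manifold M {-\<epsilon><..<\<epsilon>} \<gamma> \<and> \<gamma> 0 = p}"

text \<open>The differential at \<open>p\<close> of a map \<open>F\<close> into \<open>N\<close>; the source manifold enters only through the
  tangent vector \<open>v\<close>.\<close>

definition differential ::
  "('b, 'f::euclidean_space) manifold \<Rightarrow> ('a \<Rightarrow> 'b) \<Rightarrow> 'a \<Rightarrow> 'a tangent_vector \<Rightarrow>
   'b tangent_vector" where
  "differential N F p v = (\<lambda>h. if smooth_at N (F p) h then v (h \<circ> F) else 0)"

definition vector_field ::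
  "('a, 'e::euclidean_space) manifold \<Rightarrow> ('a \<Rightarrow> 'a tangent_vector) \<Rightarrow> bool" where
  "vector_field M X \<longleftrightarrow>
     (\<forall>p\<in>topspace (space_of M). X p \<in> tangent_space M p) \<and>
     (\<forall>p. p \<notin> topspace (space_of M) \<longrightarrow> X p = (\<lambda>f. 0)) \<and>
     (\<forall>p\<in>topspace (space_of M). \<forall>f. smooth_at M p f \<longrightarrow> smooth_at M p (\<lambda>q. X q f))"

definition bracket ::
  "('a, 'e::euclidean_space) manifold \<Rightarrow> ('a \<Rightarrow> 'a tangent_vector) \<Rightarrow> ('a \<Rightarrow> 'a tangent_vector) \<Rightarrow>
   'a \<Rightarrow> 'a tangent_vector" where
  "bracket M X Y = (\<lambda>p f. if smooth_at M p f
     then X p (\<lambda>q. Y q f) - Y p (\<lambda>q. X q f) else 0)"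

definition riemannian_metric ::
  "('a, 'e::euclidean_space) manifold \<Rightarrow>
   ('a \<Rightarrow> 'a tangent_vector \<Rightarrow> 'a tangent_vector \<Rightarrow> real) \<Rightarrow> bool" where
  "riemannian_metric M m \<longleftrightarrow>
     (\<forall>p\<in>topspace (space_of M).
        (\<forall>u\<in>tangent_space M p. \<forall>v\<in>tangent_space M p. m p u v = m p v u) \<and>
        (\<forall>u\<in>tangent_space M p. \<forall>v\<in>tangent_space M p. \<forall>w\<in>tangent_space M p. \<forall>a b.
           m p (\<lambda>f. a * u f + b * v f) w = a * m p u w + b * m p v w) \<and>
        (\<forall>u\<in>tangent_space M p. u \<noteq> (\<lambda>f. 0) \<longrightarrow> m p u u > 0)) \<and>
     (\<forall>X Y. vector_field M X \<longrightarrow> vector_field M Y \<longrightarrow>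
        smooth_map M euclidean_manifold (\<lambda>p. m p (X p) (Y p)))"


section \<open>Lie groups\<close>

text \<open>The Lie algebra consists of the left-invariant vector fields, with \<open>bracket\<close> as Lie bracket;
  evaluation at the unit carries a left-invariant metric to an inner product on it.\<close>

definition lie_group ::
  "('a, 'm) monoid_scheme \<Rightarrow> ('a, 'e::euclidean_space) manifold \<Rightarrow> bool" where
  "lie_group G M \<longleftrightarrow>
     group G \<and> smooth_manifold M \<and> topspace (space_of M) = carrier G \<and>
     smooth_map (prod_manifold M M) M (\<lambda>(x, y). x \<otimes>\<^bsub>G\<^esub> y) \<and>
     smooth_map M M (\<lambda>x. inv\<^bsub>G\<^esub> x)"

definition lie_algebra ::
  "('a, 'm) monoid_scheme \<Rightarrow> ('a, 'e::euclidean_space) manifold \<Rightarrow>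
   ('a \<Rightarrow> 'a tangent_vector) set" where
  "lie_algebra G M = {X. vector_field M X \<and>
     (\<forall>g\<in>carrier G. \<forall>p\<in>carrier G.
        X (g \<otimes>\<^bsub>G\<^esub> p) = differential M (\<lambda>q. g \<otimes>\<^bsub>G\<^esub> q) p (X p))}"

definition left_invariant_metric ::
  "('a, 'm) monoid_scheme \<Rightarrow> ('a, 'e::euclidean_space) manifold \<Rightarrow>
   ('a \<Rightarrow> 'a tangent_vector \<Rightarrow> 'a tangent_vector \<Rightarrow> real) \<Rightarrow> bool" where
  "left_invariant_metric G M m \<longleftrightarrow> riemannian_metric M m \<and>
     (\<forall>g\<in>carrier G. \<forall>p\<in>carrier G. \<forall>u\<in>tangent_space M p. \<forall>v\<in>tangent_space M p.
        m (g \<otimes>\<^bsub>G\<^esub> p) (differential M (\<lambda>q. g \<otimes>\<^bsub>G\<^esub> q) p u)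
                     (differential M (\<lambda>q. g \<otimes>\<^bsub>G\<^esub> q) p v) = m p u v)"

definition lie_algebra_inner ::
  "('a, 'm) monoid_scheme \<Rightarrow> ('a \<Rightarrow> 'a tangent_vector \<Rightarrow> 'a tangent_vector \<Rightarrow> real) \<Rightarrow>
   ('a \<Rightarrow> 'a tangent_vector) \<Rightarrow> ('a \<Rightarrow> 'a tangent_vector) \<Rightarrow> real" where
  "lie_algebra_inner G m X Y = m \<one>\<^bsub>G\<^esub> (X \<one>\<^bsub>G\<^esub>) (Y \<one>\<^bsub>G\<^esub>)"

definition cyclic_metric ::
  "('a, 'm) monoid_scheme \<Rightarrow> ('a, 'e::euclidean_space) manifold \<Rightarrow>
   ('a \<Rightarrow> 'a tangent_vector \<Rightarrow> 'a tangent_vector \<Rightarrow> real) \<Rightarrow> bool" where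
  "cyclic_metric G M m \<longleftrightarrow>
     (\<forall>X\<in>lie_algebra G M. \<forall>Y\<in>lie_algebra G M. \<forall>Z\<in>lie_algebra G M.
        lie_algebra_inner G m (bracket M X Y) Z + lie_algebra_inner G m (bracket M Y Z) X
          + lie_algebra_inner G m (bracket M Z X) Y = 0)"


section \<open>Nilpotent groups\<close>

primrec lower_central_series :: "('a, 'm) monoid_scheme \<Rightarrow> nat \<Rightarrow> 'a set" where
  "lower_central_series G 0 = carrier G"
| "lower_central_series G (Suc n) = generate G
     {x \<otimes>\<^bsub>G\<^esub> y \<otimes>\<^bsub>G\<^esub> inv\<^bsub>G\<^esub> x \<otimes>\<^bsub>G\<^esub> inv\<^bsub>G\<^esub> y | x y.
        x \<in> carrier G \<and> y \<in> lower_central_series G n}"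

definition nilpotent_group :: "('a, 'm) monoid_scheme \<Rightarrow> bool" where
  "nilpotent_group G \<longleftrightarrow> group G \<and> (\<exists>n. lower_central_series G n = {\<one>\<^bsub>G\<^esub>})"

end

theory Submission
  imports Defs
begin

text \<open>
  On Lie algebras the argument is short. A nonabelian nilpotent Lie algebra has a nonzero central
  element \<open>Z\<close> in its derived algebra. If \<open>Z\<close> is central, the cyclic identity
  \<open>\<langle>[X,Y],Z\<rangle> + \<langle>[Y,Z],X\<rangle> + \<langle>[Z,X],Y\<rangle> = 0\<close> reduces to \<open>\<langle>[X,Y],Z\<rangle> = 0\<close>; so \<open>Z\<close> is orthogonal to the
  derived algebra, hence to itself.

  Here the argument is carried out with elements of the group, where nilpotency and commutativity are
  given. The claim is that a cyclic metric forces the second center of a connected group to be equal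
  to the center (\<open>central_if_commutators_central\<close>). Let all commutators \<open>x g x\<inverse> g\<inverse>\<close> of \<open>x\<close> be central. The
  map \<open>g \<mapsto> x g x\<inverse> g\<inverse>\<close> has the derivative \<open>w = Ad x v - v\<close> at the unit in direction \<open>v\<close>. This \<open>w\<close> plays the
  role of \<open>Z\<close>. It is tangent to a curve of central elements, so its brackets vanish
  (\<open>lie_bracket_central_velocity\<close>) and \<open>w\<close> is orthogonal to all brackets. Since \<open>Ad\<close> has the derivative
  \<open>u \<mapsto> [u,\<cdot>]\<close> at the unit (\<open>Ad_has_derivative\<close>), the function \<open>z \<mapsto> \<langle>w, Ad z v\<rangle>\<close> has derivative zero, and is
  constant by connectedness (\<open>constant_if_derivative_zero\<close>). Comparing its values at \<open>x\<close> and at the unit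
  gives \<open>\<langle>w,w\<rangle> = 0\<close>. So the commutator map of \<open>x\<close>, which is a homomorphism into the center, has
  derivative zero, and \<open>x\<close> is central (\<open>commutator_trivial_if_derivative_zero\<close>).

  If the second center is the center, then every term of the lower central series of a nilpotent group
  is central, beginning with the trivial one and ending with the whole group
  (\<open>comm_group_if_second_center_central\<close>).

  The link to vector fields is \<open>bracket_left_fields\<close>: at the unit, the bracket of left-invariant fields
  is the antisymmetrized mixed second derivative of the multiplication in a chart. All identities
  between brackets are then obtained by differentiating identities between group elements twice, with
  the second-order chain rule and the symmetry of second derivatives.
\<close>

section \<open>Functions with continuous iterated derivatives\<close>

lemma Ck_on_cong:
  assumes "open S" "\<And>x. x \<in> S \<Longrightarrow> f x = g x" "Ck_on k S f"
  shows "Ck_on k S g"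
  using assms(2,3)
proof (induction k arbitrary: f g)
  case 0
  then show ?case using continuous_on_cong by (metis Ck_on.simps(1))
next
  case (Suc k)
  have D: "(g has_derivative frechet_derivative f (at x)) (at x)" if "x \<in> S" for x
    using Suc.prems that \<open>open S\<close>
    by (metis Ck_on.simps(2) frechet_derivative_works has_derivative_transform_within_open)
  have E: "frechet_derivative f (at x) v = frechet_derivative g (at x) v" if "x \<in> S" for x v
    using frechet_derivative_at[OF D[OF that]] by (rule fun_cong)
  have "Ck_on k S (\<lambda>x. frechet_derivative g (at x) v)" for v
    using Suc.IH[of "\<lambda>x. frechet_derivative f (at x) v"] E Suc.prems(2) by simp
  with D show ?case by (auto simp: differentiable_def)
qed

lemma Ck_on_subset: "Ck_on k S f \<Longrightarrow> T \<subseteq> S \<Longrightarrow> Ck_on k T f"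
  by (induction k arbitrary: f) (auto intro: continuous_on_subset)

text \<open>Coordinate expressions of a map are compared chart by chart, near one point at a time; this puts the
  local statements together.\<close>

lemma Ck_on_local:
  assumes "\<And>x. x \<in> S \<Longrightarrow> \<exists>T. open T \<and> x \<in> T \<and> Ck_on k (S \<inter> T) f"
  shows "Ck_on k S f"
  using assms
proof (induction k arbitrary: f)
  case 0
  have "continuous (at x within S) f" if "x \<in> S" for x
  proof -
    from 0[OF that] obtain T where T: "open T" "x \<in> T" "continuous_on (S \<inter> T) f" by auto
    then have "continuous (at x within S \<inter> T) f"
      using that by (simp add: continuous_on_eq_continuous_within)
    also have "at x within S \<inter> T = at x within S"
      using T by (intro at_within_nhd[of x T]) auto
    finally show ?thesis .
  qed
  then show ?case by (simp add: continuous_on_eq_continuous_within)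
next
  case (Suc k)
  show ?case unfolding Ck_on.simps
  proof (intro conjI ballI allI)
    fix x assume "x \<in> S"
    then show "f differentiable at x" using Suc.prems by (metis Ck_on.simps(2) IntI)
  next
    fix v show "Ck_on k S (\<lambda>x. frechet_derivative f (at x) v)"
      by (rule Suc.IH) (use Suc.prems in fastforce)
  qed
qed

lemma Ck_on_Suc_imp: "Ck_on (Suc k) S f \<Longrightarrow> Ck_on k S f"
proof (induction k arbitrary: f)
  case 0
  then show ?case
    by (auto intro!: continuous_at_imp_continuous_on differentiable_imp_continuous_within)
next
  case (Suc k)
  then show ?case by (metis Ck_on.simps(2))
qed

lemma Ck_on_imp_continuous_on: "Ck_on k S f \<Longrightarrow> continuous_on S f"
  by (induction k) (auto dest: Ck_on_Suc_imp simp del: Ck_on.simps(2))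

lemma Ck_on_const: "Ck_on k S (\<lambda>x. c)"
  by (induction k arbitrary: c) auto

lemma Ck_on_linear: "bounded_linear L \<Longrightarrow> Ck_on k S L"
proof (cases k)
  case 0
  assume "bounded_linear L"
  with 0 show ?thesis by (simp add: linear_continuous_on)
next
  case (Suc n)
  assume L: "bounded_linear L"
  have "(L has_derivative L) (at x)" for x
    using L bounded_linear_imp_has_derivative by blast
  from frechet_derivative_at[OF this, symmetric] this
  have "frechet_derivative L (at x) = L" "L differentiable at x" for x
    by (auto simp: differentiable_def)
  with Suc show ?thesis by (simp add: Ck_on_const)
qed

lemma Ck_on_linear_compose:
  assumes "open S" "bounded_linear L" "Ck_on k S f"
  shows "Ck_on k S (\<lambda>x. L (f x))"
  using assms(3)
proof (induction k arbitrary: f)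
  case 0
  then show ?case using assms(2) by (simp add: bounded_linear.continuous_on)
next
  case (Suc k)
  have D: "((\<lambda>x. L (f x)) has_derivative (\<lambda>v. L (frechet_derivative f (at x) v))) (at x)"
    if "x \<in> S" for x
    using Suc.prems that assms(2)
    by (simp add: bounded_linear.has_derivative frechet_derivative_works)
  have E: "frechet_derivative (\<lambda>x. L (f x)) (at x) v = L (frechet_derivative f (at x) v)"
    if "x \<in> S" for x v
    using frechet_derivative_at[OF D[OF that]] by (rule fun_cong[THEN sym])
  have "Ck_on k S (\<lambda>x. frechet_derivative (\<lambda>x. L (f x)) (at x) v)" for v
    by (rule Ck_on_cong[OF \<open>open S\<close> _ Suc.IH[of "\<lambda>x. frechet_derivative f (at x) v"]])
      (use E Suc.prems in auto)
  with D show ?case by (auto simp: differentiable_def)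
qed

lemma Ck_on_add:
  assumes "open S" "Ck_on k S f" "Ck_on k S g"
  shows "Ck_on k S (\<lambda>x. f x + g x)"
  using assms(2,3)
proof (induction k arbitrary: f g)
  case 0
  then show ?case by (simp add: continuous_on_add)
next
  case (Suc k)
  have D: "((\<lambda>x. f x + g x) has_derivative
      (\<lambda>v. frechet_derivative f (at x) v + frechet_derivative g (at x) v)) (at x)"
    if "x \<in> S" for x
    using Suc.prems that by (intro has_derivative_add) (auto simp: frechet_derivative_works)
  have E: "frechet_derivative (\<lambda>x. f x + g x) (at x) v =
      frechet_derivative f (at x) v + frechet_derivative g (at x) v"
    if "x \<in> S" for x v
    using frechet_derivative_at[OF D[OF that]] by (rule fun_cong[THEN sym])
  have "Ck_on k S (\<lambda>x. frechet_derivative (\<lambda>x. f x + g x) (at x) v)" for v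
    by (rule Ck_on_cong[OF \<open>open S\<close> _ Suc.IH[of "\<lambda>x. frechet_derivative f (at x) v"
            "\<lambda>x. frechet_derivative g (at x) v"]])
      (use E Suc.prems in auto)
  with D show ?case by (auto simp: differentiable_def)
qed

lemma Ck_on_sum:
  assumes "open S" "\<And>i. i \<in> I \<Longrightarrow> Ck_on k S (f i)"
  shows "Ck_on k S (\<lambda>x. \<Sum>i\<in>I. f i x)"
  using assms(2)
  by (induction I rule: infinite_finite_induct) (auto intro: Ck_on_const Ck_on_add[OF \<open>open S\<close>])

lemma Ck_on_scaleR:
  fixes f :: "'a::real_normed_vector \<Rightarrow> real"
  assumes "open S" "Ck_on k S f" "Ck_on k S g"
  shows "Ck_on k S (\<lambda>x. f x *\<^sub>R g x)"
  using assms(2,3)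
proof (induction k arbitrary: f g)
  case 0
  then show ?case by (simp add: continuous_on_scaleR)
next
  case (Suc k)
  have D: "((\<lambda>x. f x *\<^sub>R g x) has_derivative
      (\<lambda>v. f x *\<^sub>R frechet_derivative g (at x) v + frechet_derivative f (at x) v *\<^sub>R g x)) (at x)"
    if "x \<in> S" for x
    using Suc.prems that by (intro has_derivative_scaleR) (auto simp: frechet_derivative_works)
  have E: "frechet_derivative (\<lambda>x. f x *\<^sub>R g x) (at x) v =
      f x *\<^sub>R frechet_derivative g (at x) v + frechet_derivative f (at x) v *\<^sub>R g x"
    if "x \<in> S" for x v
    using frechet_derivative_at[OF D[OF that]] by (rule fun_cong[THEN sym])
  have "Ck_on k S (\<lambda>x. f x *\<^sub>R frechet_derivative g (at x) v + frechet_derivative f (at x) v *\<^sub>R g x)"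
    for v
    using Suc.prems by (intro Ck_on_add[OF \<open>open S\<close>] Suc.IH) (auto dest: Ck_on_Suc_imp
        simp del: Ck_on.simps(2), auto)
  then have "Ck_on k S (\<lambda>x. frechet_derivative (\<lambda>x. f x *\<^sub>R g x) (at x) v)" for v
    by (rule Ck_on_cong[OF \<open>open S\<close>, rotated]) (use E in auto)
  with D show ?case by (auto simp: differentiable_def)
qed

lemma linear_eq_sum_Basis:
  fixes L :: "'e::euclidean_space \<Rightarrow> 'f::real_normed_vector"
  assumes "linear L"
  shows "L v = (\<Sum>i\<in>Basis. (v \<bullet> i) *\<^sub>R L i)"
  by (metis (no_types, lifting) assms euclidean_representation linear_sum linear_scale sum.cong)

text \<open>The derivative of \<open>g \<circ> f\<close> in direction \<open>v\<close> is \<open>Dg\<close> at \<open>f x\<close> applied to the moving direction \<open>Df(x) v\<close>,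
  whereas the induction hypothesis speaks of \<open>Dg\<close> in a fixed direction. Expanding \<open>Df(x) v\<close> in the
  basis of the middle space reduces the former to the latter.\<close>

lemma Ck_on_compose:
  fixes f :: "'a::real_normed_vector \<Rightarrow> 'b::euclidean_space" and g :: "'b \<Rightarrow> 'c::real_normed_vector"
  assumes "open S" "open T" "f ` S \<subseteq> T" "Ck_on k S f" "Ck_on k T g"
  shows "Ck_on k S (\<lambda>x. g (f x))"
  using assms(4,5)
proof (induction k arbitrary: g)
  case 0
  then show ?case using assms(3) by (auto intro: continuous_on_compose2)
next
  case (Suc k)
  have D: "((\<lambda>x. g (f x)) has_derivative
      (\<lambda>v. frechet_derivative g (at (f x)) (frechet_derivative f (at x) v))) (at x)"
    if "x \<in> S" for x
    using Suc.prems that assms(3)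
    by (intro has_derivative_compose[where g=g and f=f]) (auto simp: frechet_derivative_works)
  have E: "frechet_derivative (\<lambda>x. g (f x)) (at x) v =
      (\<Sum>i\<in>Basis. (frechet_derivative f (at x) v \<bullet> i) *\<^sub>R frechet_derivative g (at (f x)) i)"
    if "x \<in> S" for x v
  proof -
    have "linear (frechet_derivative g (at (f x)))"
      using Suc.prems assms(3) that by (auto intro!: linear_frechet_derivative)
    from linear_eq_sum_Basis[OF this] show ?thesis
      unfolding frechet_derivative_at[OF D[OF that], symmetric] .
  qed
  have "Ck_on k S (\<lambda>x. \<Sum>i\<in>Basis. (frechet_derivative f (at x) v \<bullet> i) *\<^sub>R
      frechet_derivative g (at (f x)) i)" for v
  proof (intro Ck_on_sum[OF \<open>open S\<close>] Ck_on_scaleR[OF \<open>open S\<close>])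
    fix i
    show "Ck_on k S (\<lambda>x. frechet_derivative f (at x) v \<bullet> i)"
      using Suc.prems(1)
      by (intro Ck_on_linear_compose[OF \<open>open S\<close>, of "\<lambda>y. y \<bullet> i"] bounded_linear_inner_left) auto
    show "Ck_on k S (\<lambda>x. frechet_derivative g (at (f x)) i)"
      using Suc.prems Suc.IH[of "\<lambda>y. frechet_derivative g (at y) i"]
        Ck_on_Suc_imp[OF Suc.prems(1)] by auto
  qed
  then have "Ck_on k S (\<lambda>x. frechet_derivative (\<lambda>x. g (f x)) (at x) v)" for v
    by (rule Ck_on_cong[OF \<open>open S\<close>, rotated]) (use E in auto)
  with D show ?case by (auto simp: differentiable_def)
qed

lemma Ck_on_Pair:
  assumes "open S" "Ck_on k S f" "Ck_on k S g"
  shows "Ck_on k S (\<lambda>x. (f x, g x))"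
proof -
  have "Ck_on k S (\<lambda>x. (f x, 0) + (0, g x))"
    using assms
    by (intro Ck_on_add Ck_on_linear_compose[where L="\<lambda>y. (y, 0)"]
        Ck_on_linear_compose[where L="\<lambda>y. (0, y)"] bounded_linear_Pair
        bounded_linear_ident bounded_linear_zero)
  then show ?thesis by simp
qed

section \<open>Second derivatives\<close>

text \<open>The last argument is the direction of the inner differentiation, the one before it the direction
  of the outer.\<close>

definition second_derivative ::
  "('a::real_normed_vector \<Rightarrow> 'b::real_normed_vector) \<Rightarrow> 'a \<Rightarrow> 'a \<Rightarrow> 'a \<Rightarrow> 'b" where
  "second_derivative f z p q = frechet_derivative (\<lambda>y. frechet_derivative f (at y) q) (at z) p"

lemma smooth_on_differentiable: "smooth_on S f \<Longrightarrow> z \<in> S \<Longrightarrow> f differentiable at z"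
  unfolding smooth_on_def by (metis Ck_on.simps(2))

lemma smooth_on_has_derivative:
  "smooth_on S f \<Longrightarrow> z \<in> S \<Longrightarrow> (f has_derivative frechet_derivative f (at z)) (at z)"
  using smooth_on_differentiable frechet_derivative_works by blast

lemma smooth_on_frechet_derivative:
  "smooth_on S f \<Longrightarrow> smooth_on S (\<lambda>y. frechet_derivative f (at y) q)"
  unfolding smooth_on_def by (metis Ck_on.simps(2))

lemma smooth_on_has_second_derivative:
  "smooth_on S f \<Longrightarrow> z \<in> S \<Longrightarrow>
    ((\<lambda>y. frechet_derivative f (at y) q) has_derivative (\<lambda>p. second_derivative f z p q)) (at z)"
  unfolding second_derivative_def
  by (metis smooth_on_frechet_derivative smooth_on_has_derivative)

text \<open>Linearity in the outer direction is part of being a derivative. Linearity in the inner direction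
  comes from that of the first derivative at all points near \<open>z\<close>.\<close>

lemma linear_second_derivative:
  assumes S: "open S" and f: "smooth_on S f" and z: "z \<in> S"
  shows "linear (second_derivative f z p)"
proof
  fix a b :: 'a and r :: real
  let ?D = frechet_derivative
  have lin: "linear (?D f (at y))" if "y \<in> S" for y
    using that f by (auto intro!: linear_frechet_derivative smooth_on_differentiable)
  note H = smooth_on_has_second_derivative[OF f z]
  have "((\<lambda>y. ?D f (at y) (a + b)) has_derivative
      (\<lambda>p. second_derivative f z p a + second_derivative f z p b)) (at z)"
    by (rule has_derivative_transform_within_open[OF has_derivative_add[OF H H] S z])
      (use lin in \<open>auto simp: linear_add\<close>)
  from has_derivative_unique[OF this H] 
  show "second_derivative f z p (a + b) = second_derivative f z p a + second_derivative f z p b"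
    by (simp add: fun_eq_iff)
  have "((\<lambda>y. ?D f (at y) (r *\<^sub>R a)) has_derivative
      (\<lambda>p. r *\<^sub>R second_derivative f z p a)) (at z)"
    by (rule has_derivative_transform_within_open[OF has_derivative_scaleR_right[OF H] S z])
      (use lin in \<open>auto simp: linear_scale\<close>)
  from has_derivative_unique[OF this H]
  show "second_derivative f z p (r *\<^sub>R a) = r *\<^sub>R second_derivative f z p a"
    by (simp add: fun_eq_iff)
qed

text \<open>As for first derivatives, the direction \<open>Df(y) q\<close> moves with \<open>y\<close>. Expanded in a basis it gives a sum
  of products, and the two terms of the product rule are the two terms on the right.\<close>

lemma second_derivative_compose:
  fixes f :: "'a::real_normed_vector \<Rightarrow> 'b::euclidean_space" and g :: "'b \<Rightarrow> 'c::real_normed_vector"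
  assumes S: "open S" and oT: "open T" and T: "f ` S \<subseteq> T" and f: "smooth_on S f" and g: "smooth_on T g"
    and z: "z \<in> S"
  shows "second_derivative (\<lambda>x. g (f x)) z p q =
    second_derivative g (f z) (frechet_derivative f (at z) p) (frechet_derivative f (at z) q)
    + frechet_derivative g (at (f z)) (second_derivative f z p q)"
proof -
  let ?D = frechet_derivative
  have lin: "linear (?D g (at (f y)))" if "y \<in> S" for y
    using that T g by (auto intro!: linear_frechet_derivative smooth_on_differentiable)
  have E: "?D (\<lambda>x. g (f x)) (at y) q = (\<Sum>i\<in>Basis. (?D f (at y) q \<bullet> i) *\<^sub>R ?D g (at (f y)) i)"
    if "y \<in> S" for y
  proof -
    have "((\<lambda>x. g (f x)) has_derivative (\<lambda>v. ?D g (at (f y)) (?D f (at y) v))) (at y)"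
      using f g T that
      by (intro has_derivative_compose[where g=g and f=f] smooth_on_has_derivative) auto
    from frechet_derivative_at[OF this, symmetric] show ?thesis
      using linear_eq_sum_Basis[OF lin[OF that], of "?D f (at y) q"] by (simp only:)
  qed
  have fz: "f z \<in> T" using T z by auto
  have D1: "((\<lambda>y. ?D f (at y) q \<bullet> i) has_derivative (\<lambda>p. second_derivative f z p q \<bullet> i)) (at z)" for i
    using smooth_on_has_second_derivative[OF f z] by (rule has_derivative_inner_left)
  have D2: "((\<lambda>y. ?D g (at (f y)) i) has_derivative
      (\<lambda>p. second_derivative g (f z) (?D f (at z) p) i)) (at z)" for i
    using has_derivative_compose[OF smooth_on_has_derivative[OF f z]
        smooth_on_has_second_derivative[OF g fz]] .
  have "((\<lambda>y. \<Sum>i\<in>Basis. (?D f (at y) q \<bullet> i) *\<^sub>R ?D g (at (f y)) i) has_derivative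
      (\<lambda>p. \<Sum>i\<in>Basis. (?D f (at z) q \<bullet> i) *\<^sub>R second_derivative g (f z) (?D f (at z) p) i
        + (second_derivative f z p q \<bullet> i) *\<^sub>R ?D g (at (f z)) i)) (at z)"
    by (intro has_derivative_sum has_derivative_scaleR D1 D2)
  then have "((\<lambda>y. ?D (\<lambda>x. g (f x)) (at y) q) has_derivative
      (\<lambda>p. \<Sum>i\<in>Basis. (?D f (at z) q \<bullet> i) *\<^sub>R second_derivative g (f z) (?D f (at z) p) i
        + (second_derivative f z p q \<bullet> i) *\<^sub>R ?D g (at (f z)) i)) (at z)"
    by (rule has_derivative_transform_within_open[OF _ S z]) (use E in auto)
  from frechet_derivative_at[OF this, symmetric]
  have "second_derivative (\<lambda>x. g (f x)) z p q =
     (\<Sum>i\<in>Basis. (?D f (at z) q \<bullet> i) *\<^sub>R second_derivative g (f z) (?D f (at z) p) i)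
        + (\<Sum>i\<in>Basis. (second_derivative f z p q \<bullet> i) *\<^sub>R ?D g (at (f z)) i)"
    by (simp add: second_derivative_def sum.distrib)
  also have "(\<Sum>i\<in>Basis. (?D f (at z) q \<bullet> i) *\<^sub>R second_derivative g (f z) (?D f (at z) p) i)
      = second_derivative g (f z) (?D f (at z) p) (?D f (at z) q)"
    by (rule linear_eq_sum_Basis[OF linear_second_derivative[OF oT g fz], symmetric])
  also have "(\<Sum>i\<in>Basis. (second_derivative f z p q \<bullet> i) *\<^sub>R ?D g (at (f z)) i)
      = ?D g (at (f z)) (second_derivative f z p q)"
    by (rule linear_eq_sum_Basis[OF lin[OF z], symmetric])
  finally show ?thesis .
qed

lemma second_derivative_linear_compose:
  assumes S: "open S" and L: "bounded_linear L" and f: "smooth_on S f" and z: "z \<in> S"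
  shows "second_derivative (\<lambda>x. L (f x)) z p q = L (second_derivative f z p q)"
proof -
  let ?D = frechet_derivative
  have E: "L (?D f (at y) q) = ?D (\<lambda>x. L (f x)) (at y) q" if "y \<in> S" for y
    using frechet_derivative_at[OF bounded_linear.has_derivative[OF L smooth_on_has_derivative[OF f that]]]
    by (rule fun_cong)
  have "((\<lambda>y. L (?D f (at y) q)) has_derivative (\<lambda>p. L (second_derivative f z p q))) (at z)"
    using bounded_linear.has_derivative[OF L smooth_on_has_second_derivative[OF f z]] .
  then have "((\<lambda>y. ?D (\<lambda>x. L (f x)) (at y) q) has_derivative
      (\<lambda>p. L (second_derivative f z p q))) (at z)"
    by (rule has_derivative_transform_within_open[OF _ S z]) (rule E)
  from frechet_derivative_at[OF this, symmetric] show ?thesis by (simp add: second_derivative_def)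
qed

text \<open>The mean value theorem, first along \<open>p\<close> and then along \<open>q\<close>. The left-hand side is symmetric in \<open>p\<close>
  and \<open>q\<close>, which is where the symmetry of second derivatives comes from.\<close>

lemma double_difference_eq_second_derivative:
  fixes f :: "'a::real_normed_vector \<Rightarrow> real"
  assumes f: "smooth_on S f" and h: "0 < h"
    and sub: "\<And>s t. 0 \<le> s \<Longrightarrow> s \<le> h \<Longrightarrow> 0 \<le> t \<Longrightarrow> t \<le> h \<Longrightarrow> z + s *\<^sub>R p + t *\<^sub>R q \<in> S"
  obtains s t where "0 < s" "s < h" "0 < t" "t < h"
    "f (z + h *\<^sub>R p + h *\<^sub>R q) - f (z + h *\<^sub>R p) - f (z + h *\<^sub>R q) + f z
      = h * h * second_derivative f (z + s *\<^sub>R p + t *\<^sub>R q) q p"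
proof -
  let ?D = frechet_derivative
  have D1: "DERIV (\<lambda>s. f (z + s *\<^sub>R p + t *\<^sub>R q)) s :> ?D f (at (z + s *\<^sub>R p + t *\<^sub>R q)) p"
    if "0 \<le> s" "s \<le> h" "0 \<le> t" "t \<le> h" for s t
  proof -
    have "((\<lambda>s. z + s *\<^sub>R p + t *\<^sub>R q) has_derivative (\<lambda>r. r *\<^sub>R p)) (at s)"
      by (auto intro!: derivative_eq_intros)
    from has_derivative_compose[OF this smooth_on_has_derivative[OF f sub[OF that]]]
    show ?thesis
      using linear_frechet_derivative[OF smooth_on_differentiable[OF f sub[OF that]]]
      by (simp add: has_field_derivative_def linear_scale mult_commute_abs)
  qed
  have D2: "DERIV (\<lambda>t. ?D f (at (z + s *\<^sub>R p + t *\<^sub>R q)) p) t :>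
      second_derivative f (z + s *\<^sub>R p + t *\<^sub>R q) q p"
    if "0 \<le> s" "s \<le> h" "0 \<le> t" "t \<le> h" for s t
  proof -
    have "((\<lambda>t. z + s *\<^sub>R p + t *\<^sub>R q) has_derivative (\<lambda>r. r *\<^sub>R q)) (at t)"
      by (auto intro!: derivative_eq_intros)
    note H = smooth_on_has_second_derivative[OF f sub[OF that], of p]
    from has_derivative_compose[OF \<open>((\<lambda>t. z + s *\<^sub>R p + t *\<^sub>R q) has_derivative (\<lambda>r. r *\<^sub>R q)) (at t)\<close> H]
    moreover have "second_derivative f (z + s *\<^sub>R p + t *\<^sub>R q) (r *\<^sub>R q) p
        = r * second_derivative f (z + s *\<^sub>R p + t *\<^sub>R q) q p" for r
      using linear_scale[OF has_derivative_linear[OF H], of r q] by simp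
    ultimately show ?thesis
      by (simp add: has_field_derivative_def mult_commute_abs)
  qed
  obtain s where s: "0 < s" "s < h" and
    "(f (z + h *\<^sub>R p + h *\<^sub>R q) - f (z + h *\<^sub>R p + 0 *\<^sub>R q)) - (f (z + 0 *\<^sub>R p + h *\<^sub>R q) - f (z + 0 *\<^sub>R p + 0 *\<^sub>R q))
     = (h - 0) * (?D f (at (z + s *\<^sub>R p + h *\<^sub>R q)) p - ?D f (at (z + s *\<^sub>R p + 0 *\<^sub>R q)) p)"
    using MVT2[of 0 h "\<lambda>s. f (z + s *\<^sub>R p + h *\<^sub>R q) - f (z + s *\<^sub>R p + 0 *\<^sub>R q)", OF h DERIV_diff[OF D1 D1]]
    h by auto
  moreover obtain t where "0 < t" "t < h" and
    "?D f (at (z + s *\<^sub>R p + h *\<^sub>R q)) p - ?D f (at (z + s *\<^sub>R p + 0 *\<^sub>R q)) p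
      = (h - 0) * second_derivative f (z + s *\<^sub>R p + t *\<^sub>R q) q p"
    using MVT2[of 0 h "\<lambda>t. ?D f (at (z + s *\<^sub>R p + t *\<^sub>R q)) p", OF h D2] s by auto
  ultimately show ?thesis using that[of s t] by (simp add: algebra_simps)
qed

lemma smooth_on_continuous_second_derivative:
  "smooth_on S f \<Longrightarrow> continuous_on S (\<lambda>z. second_derivative f z p q)"
  unfolding second_derivative_def
  using smooth_on_frechet_derivative[of S "\<lambda>y. frechet_derivative f (at y) q" p]
    smooth_on_frechet_derivative[of S f q]
  by (meson Ck_on_imp_continuous_on smooth_on_def)

text \<open>The double difference of a small parallelogram, evaluated in the two orders, equates the two mixed
  derivatives at two points near \<open>z\<close>. Were they different at \<open>z\<close>, continuity would keep them apart.\<close>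

lemma second_derivative_symmetric_real:
  fixes f :: "'a::real_normed_vector \<Rightarrow> real"
  assumes S: "open S" and f: "smooth_on S f" and z: "z \<in> S"
  shows "second_derivative f z p q = second_derivative f z q p"
proof (rule ccontr)
  let ?d = "\<lambda>x p q. second_derivative f x p q"
  assume ne: "?d z p q \<noteq> ?d z q p"
  define e where "e = \<bar>?d z p q - ?d z q p\<bar> / 2"
  have e: "e > 0" using ne by (simp add: e_def)
  have "\<exists>r>0. \<forall>x. dist x z < r \<longrightarrow> x \<in> S \<and> dist (?d x a b) (?d z a b) < e" for a b
  proof -
    obtain r1 where r1: "r1 > 0" "\<And>x. dist x z < r1 \<Longrightarrow> x \<in> S"
      using S z unfolding open_dist by blast
    obtain r2 where r2: "r2 > 0" "\<And>x. x \<in> S \<Longrightarrow> dist x z < r2 \<Longrightarrow> dist (?d x a b) (?d z a b) < e"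
      using smooth_on_continuous_second_derivative[OF f, of a b] z e unfolding continuous_on_iff by meson
    show ?thesis by (rule exI[of _ "min r1 r2"]) (use r1 r2 in auto)
  qed
  from this[of p q] this[of q p] obtain r1 r2 where r: "r1 > 0" "r2 > 0"
    and r1: "\<And>x. dist x z < r1 \<Longrightarrow> x \<in> S \<and> dist (?d x p q) (?d z p q) < e"
    and r2: "\<And>x. dist x z < r2 \<Longrightarrow> dist (?d x q p) (?d z q p) < e" by blast
  \<comment> \<open>small enough for the parallelogram with sides \<open>h p\<close> and \<open>h q\<close> to stay within the smaller radius\<close>
  define h where "h = min r1 r2 / (2 * (norm p + norm q + 1))"
  have np: "norm p + norm q + 1 > 0" by (simp add: add_nonneg_pos)
  have h: "h > 0" using r np by (simp add: h_def)
  have near: "dist (z + s *\<^sub>R p + t *\<^sub>R q) z < min r1 r2" if "0 \<le> s" "s \<le> h" "0 \<le> t" "t \<le> h" for s t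
  proof -
    have "dist (z + s *\<^sub>R p + t *\<^sub>R q) z = norm (s *\<^sub>R p + t *\<^sub>R q)"
      by (simp add: dist_norm add.assoc)
    also have "\<dots> \<le> s * norm p + t * norm q"
      using norm_triangle_ineq[of "s *\<^sub>R p" "t *\<^sub>R q"] that by simp
    also have "\<dots> \<le> h * norm p + h * norm q" using that by (intro add_mono mult_right_mono) auto
    also have "\<dots> < h * (2 * (norm p + norm q + 1))"
    proof -
      have "0 < h * (norm p + norm q + 2)" using h by (simp add: add_nonneg_pos)
      then show ?thesis by (simp add: algebra_simps)
    qed
    also have "\<dots> = min r1 r2" using np by (simp add: h_def)
    finally show ?thesis .
  qed
  have sub1: "z + s *\<^sub>R p + t *\<^sub>R q \<in> S" if "0 \<le> s" "s \<le> h" "0 \<le> t" "t \<le> h" for s t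
    using near[OF that] r1 by simp
  have sub2: "z + s *\<^sub>R q + t *\<^sub>R p \<in> S" if "0 \<le> s" "s \<le> h" "0 \<le> t" "t \<le> h" for s t
    using sub1[OF that(3,4,1,2)] by (simp add: add.assoc add.commute add.left_commute)
  obtain s t where st: "0 < s" "s < h" "0 < t" "t < h"
    and A: "f (z + h *\<^sub>R p + h *\<^sub>R q) - f (z + h *\<^sub>R p) - f (z + h *\<^sub>R q) + f z
      = h * h * ?d (z + s *\<^sub>R p + t *\<^sub>R q) q p"
    using double_difference_eq_second_derivative[OF f h sub1] by blast
  obtain s' t' where st': "0 < s'" "s' < h" "0 < t'" "t' < h"
    and B: "f (z + h *\<^sub>R q + h *\<^sub>R p) - f (z + h *\<^sub>R q) - f (z + h *\<^sub>R p) + f z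
      = h * h * ?d (z + s' *\<^sub>R q + t' *\<^sub>R p) p q"
    using double_difference_eq_second_derivative[OF f h sub2] by blast
  have sw: "z + a *\<^sub>R q + b *\<^sub>R p = z + b *\<^sub>R p + a *\<^sub>R q" for a b
    by (simp add: add.assoc add.commute)
  have "h * h * ?d (z + s *\<^sub>R p + t *\<^sub>R q) q p = h * h * ?d (z + t' *\<^sub>R p + s' *\<^sub>R q) p q"
    using A B unfolding sw by linarith
  then have eq: "?d (z + s *\<^sub>R p + t *\<^sub>R q) q p = ?d (z + t' *\<^sub>R p + s' *\<^sub>R q) p q"
    using h by simp
  have "dist (?d (z + s *\<^sub>R p + t *\<^sub>R q) q p) (?d z q p) < e"
    using near[of s t] st r2 by simp
  moreover have "dist (?d (z + t' *\<^sub>R p + s' *\<^sub>R q) p q) (?d z p q) < e"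
    using near[of t' s'] st' r1 by simp
  ultimately have "\<bar>?d z p q - ?d z q p\<bar> < 2 * e"
    unfolding eq dist_real_def by linarith
  then show False by (simp add: e_def)
qed

lemma second_derivative_symmetric:
  fixes f :: "'a::real_normed_vector \<Rightarrow> 'b::euclidean_space"
  assumes S: "open S" and f: "smooth_on S f" and z: "z \<in> S"
  shows "second_derivative f z p q = second_derivative f z q p"
proof (rule euclidean_eqI)
  fix b :: 'b
  note L = bounded_linear_inner_left[of b]
  have "smooth_on S (\<lambda>x. f x \<bullet> b)"
    using f Ck_on_linear_compose[OF S L] unfolding smooth_on_def by blast
  from second_derivative_symmetric_real[OF S this z, of p q]
  show "second_derivative f z p q \<bullet> b = second_derivative f z q p \<bullet> b"
    by (simp add: second_derivative_linear_compose[OF S L f z])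
qed

section \<open>Smooth germs between manifolds\<close>

lemma smooth_on_cong: "open S \<Longrightarrow> (\<And>x. x \<in> S \<Longrightarrow> f x = g x) \<Longrightarrow> smooth_on S f \<Longrightarrow> smooth_on S g"
  unfolding smooth_on_def using Ck_on_cong by blast

lemma smooth_on_subset: "smooth_on S f \<Longrightarrow> T \<subseteq> S \<Longrightarrow> smooth_on T f"
  unfolding smooth_on_def using Ck_on_subset by blast

lemma smooth_on_compose:
  fixes f :: "'a::real_normed_vector \<Rightarrow> 'b::euclidean_space" and g :: "'b \<Rightarrow> 'c::real_normed_vector"
  shows "open S \<Longrightarrow> open T \<Longrightarrow> f ` S \<subseteq> T \<Longrightarrow> smooth_on S f \<Longrightarrow> smooth_on T g \<Longrightarrow> smooth_on S (\<lambda>x. g (f x))"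
  unfolding smooth_on_def using Ck_on_compose by blast

lemma smooth_on_Pair:
  "open S \<Longrightarrow> smooth_on S f \<Longrightarrow> smooth_on S g \<Longrightarrow> smooth_on S (\<lambda>x. (f x, g x))"
  unfolding smooth_on_def using Ck_on_Pair by blast

lemma smooth_on_linear: "bounded_linear L \<Longrightarrow> smooth_on S L"
  unfolding smooth_on_def using Ck_on_linear by blast

lemma smooth_on_const: "smooth_on S (\<lambda>x. c)"
  unfolding smooth_on_def using Ck_on_const by blast

lemma smooth_on_imp_continuous_on: "smooth_on S f \<Longrightarrow> continuous_on S f"
  unfolding smooth_on_def using Ck_on_imp_continuous_on by blast

text \<open>Smoothness of maps is a matter of charts, so the chart conditions on a manifold are collected in a
  predicate of their own.\<close>

definition smooth_atlas :: "('a, 'e::euclidean_space) manifold \<Rightarrow> bool" where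
  "smooth_atlas M \<longleftrightarrow>
     (\<forall>c\<in>atlas M. is_chart (space_of M) c) \<and>
     (\<Union>(V, \<phi>)\<in>atlas M. V) = topspace (space_of M) \<and>
     (\<forall>(V, \<phi>)\<in>atlas M. \<forall>(W, \<psi>)\<in>atlas M. smooth_on (\<phi> ` (V \<inter> W)) (\<psi> \<circ> inv_into V \<phi>))"

text \<open>Smoothness of the germ of \<open>F\<close> at \<open>p\<close>. One pair of charts is enough: by \<open>smooth_near_charts\<close> below
  every other pair then serves as well. Germs can be composed and paired without keeping track of
  domains, which is why smoothness is handled pointwise throughout.\<close>

definition smooth_near ::
  "('a, 'e::euclidean_space) manifold \<Rightarrow> ('b, 'f::euclidean_space) manifold \<Rightarrow> 'a \<Rightarrow> ('a \<Rightarrow> 'b) \<Rightarrow> bool"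
  where
  "smooth_near M N p F \<longleftrightarrow> (\<exists>V \<phi> W \<psi> U. (V, \<phi>) \<in> atlas M \<and> (W, \<psi>) \<in> atlas N \<and>
     openin (space_of M) U \<and> p \<in> U \<and> U \<subseteq> V \<and> F ` U \<subseteq> W \<and>
     smooth_on (\<phi> ` U) (\<lambda>x. \<psi> (F (inv_into V \<phi> x))))"

lemma chart_inj:
  assumes "is_chart T (V, \<phi>)" shows "inj_on \<phi> V"
proof -
  have "V \<subseteq> topspace T" using assms openin_subset by (auto simp: is_chart_def)
  then show ?thesis using assms by (auto simp: is_chart_def homeomorphic_map_def Int_absorb1)
qed

lemma chart_open: "is_chart T (V, \<phi>) \<Longrightarrow> openin T V"
  by (simp add: is_chart_def)

lemma chart_open_image:
  assumes "is_chart T (V, \<phi>)" "openin T U" "U \<subseteq> V" shows "open (\<phi> ` U)"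
proof -
  have "open_map (subtopology T V) (top_of_set (\<phi> ` V)) \<phi>" "open (\<phi> ` V)"
    using assms(1) by (auto simp: is_chart_def homeomorphic_imp_open_map)
  moreover have "openin (subtopology T V) U" using assms by (simp add: openin_subset_topspace_eq
        openin_open_subtopology chart_open)
  ultimately show ?thesis by (metis open_map_def openin_open_eq)
qed

lemma chart_continuous:
  assumes "is_chart T (V, \<phi>)" shows "continuous_map (subtopology T V) euclidean \<phi>"
  using assms homeomorphic_imp_continuous_map[of "subtopology T V" "top_of_set (\<phi> ` V)" \<phi>]
    continuous_map_into_fulltopology by (auto simp: is_chart_def)

lemma chart_inv_continuous:
  assumes "is_chart T (V, \<phi>)" shows "continuous_map (top_of_set (\<phi> ` V)) T (inv_into V \<phi>)"
proof -
  obtain g where g: "homeomorphic_maps (subtopology T V) (top_of_set (\<phi> ` V)) \<phi> g"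
    using assms by (auto simp: is_chart_def homeomorphic_map_maps)
  have V: "V \<subseteq> topspace T" using assms openin_subset by (auto simp: is_chart_def)
  have "g x = inv_into V \<phi> x" if "x \<in> \<phi> ` V" for x
    using g that chart_inj[OF assms] V
    by (auto simp: homeomorphic_maps_def Int_absorb1)
  moreover have "continuous_map (top_of_set (\<phi> ` V)) T g"
    using g continuous_map_into_fulltopology by (auto simp: homeomorphic_maps_def)
  ultimately show ?thesis by (auto intro: continuous_map_eq)
qed

lemma smooth_atlas_chart: "smooth_atlas M \<Longrightarrow> (V, \<phi>) \<in> atlas M \<Longrightarrow> is_chart (space_of M) (V, \<phi>)"
  by (auto simp: smooth_atlas_def)

lemma smooth_atlas_transition:
  "smooth_atlas M \<Longrightarrow> (V, \<phi>) \<in> atlas M \<Longrightarrow> (W, \<psi>) \<in> atlas M \<Longrightarrow>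
    smooth_on (\<phi> ` (V \<inter> W)) (\<lambda>x. \<psi> (inv_into V \<phi> x))"
  by (fastforce simp: smooth_atlas_def comp_def)

lemma smooth_atlas_cover:
  assumes "smooth_atlas M" "p \<in> topspace (space_of M)"
  obtains V \<phi> where "(V, \<phi>) \<in> atlas M" "p \<in> V"
proof -
  have "p \<in> (\<Union>(V, \<phi>)\<in>atlas M. V)" using assms by (simp add: smooth_atlas_def)
  then show ?thesis using that by auto
qed

text \<open>On \<open>U\<close> the map is its coordinate expression preceded by a chart and followed by an inverse chart.\<close>

lemma continuous_on_open_chart_expression:
  assumes V: "is_chart T (V, \<phi>)" and W: "is_chart T' (W, \<psi>)"
    and U: "openin T U" "U \<subseteq> V" "F ` U \<subseteq> W"
    and s: "continuous_on (\<phi> ` U) (\<lambda>x. \<psi> (F (inv_into V \<phi> x)))"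
  shows "continuous_map (subtopology T U) T' F"
proof -
  let ?h = "\<lambda>x. \<psi> (F (inv_into V \<phi> x))"
  have UT: "U \<subseteq> topspace T" using U openin_subset by blast
  have "continuous_map (subtopology T U) (top_of_set (\<phi> ` U)) \<phi>"
    using chart_continuous[OF V] U
    by (auto simp: continuous_map_in_subtopology intro: continuous_map_from_subtopology_mono)
  moreover have "continuous_map (top_of_set (\<phi> ` U)) (top_of_set (\<psi> ` W)) ?h"
    using s U chart_inj[OF V] by (auto simp: continuous_map_in_subtopology subset_eq)
  ultimately have "continuous_map (subtopology T U) T' (inv_into W \<psi> \<circ> (?h \<circ> \<phi>))"
    by (intro continuous_map_compose[OF _ chart_inv_continuous[OF W]] continuous_map_compose)
  moreover have "(inv_into W \<psi> \<circ> (?h \<circ> \<phi>)) q = F q" if "q \<in> U" for q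
    using that U chart_inj[OF V] chart_inj[OF W] by (auto simp: subset_eq)
  ultimately show ?thesis using UT by (auto intro: continuous_map_eq)
qed

text \<open>In new charts the coordinate expression is the old one between two transition maps, on the open set
  of points that all four charts can see.\<close>

lemma smooth_near_charts:
  assumes M: "smooth_atlas M" and N: "smooth_atlas N" and F: "smooth_near M N p F"
    and V: "(V, \<phi>) \<in> atlas M" "p \<in> V" and W: "(W, \<psi>) \<in> atlas N" "F p \<in> W"
  obtains U where "openin (space_of M) U" "p \<in> U" "U \<subseteq> V" "F ` U \<subseteq> W"
    "smooth_on (\<phi> ` U) (\<lambda>x. \<psi> (F (inv_into V \<phi> x)))"
    "continuous_map (subtopology (space_of M) U) (space_of N) F"
proof -
  from F obtain V0 \<phi>0 W0 \<psi>0 U0 where 0: "(V0, \<phi>0) \<in> atlas M" "(W0, \<psi>0) \<in> atlas N"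
    "openin (space_of M) U0" "p \<in> U0" "U0 \<subseteq> V0" "F ` U0 \<subseteq> W0"
    and s0: "smooth_on (\<phi>0 ` U0) (\<lambda>x. \<psi>0 (F (inv_into V0 \<phi>0 x)))"
    unfolding smooth_near_def by blast
  note cV = smooth_atlas_chart[OF M V(1)] note cW = smooth_atlas_chart[OF N W(1)]
  note cV0 = smooth_atlas_chart[OF M 0(1)] note cW0 = smooth_atlas_chart[OF N 0(2)]
  have cont: "continuous_map (subtopology (space_of M) U0) (space_of N) F"
    using continuous_on_open_chart_expression[OF cV0 cW0 0(3,5,6) smooth_on_imp_continuous_on[OF s0]] .
  define U where "U = {q \<in> U0 \<inter> V. F q \<in> W}"
  have "openin (subtopology (space_of M) U0) {q \<in> topspace (subtopology (space_of M) U0). F q \<in> W}"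
    using cont chart_open[OF cW] by (rule openin_continuous_map_preimage)
  moreover have "U0 \<subseteq> topspace (space_of M)" using 0(3) openin_subset by blast
  ultimately have "openin (space_of M) {q \<in> U0. F q \<in> W}"
    using 0(3) by (simp add: openin_open_subtopology Int_absorb1)
  then have "openin (space_of M) ({q \<in> U0. F q \<in> W} \<inter> V)"
    using chart_open[OF cV] by blast
  moreover have "{q \<in> U0. F q \<in> W} \<inter> V = U" by (auto simp: U_def)
  ultimately have oU: "openin (space_of M) U" by simp
  have Us: "U \<subseteq> U0" "U \<subseteq> V" "U \<subseteq> V0" "F ` U \<subseteq> W" "F ` U \<subseteq> W0" using 0 by (auto simp: U_def)
  note i = inv_into_f_f[OF chart_inj[OF cV]] inv_into_f_f[OF chart_inj[OF cV0]]
    inv_into_f_f[OF chart_inj[OF cW0]]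
  have o1: "open (\<phi> ` U)" and o2: "open (\<phi>0 ` U)" and o3: "open (\<psi>0 ` (W0 \<inter> W))"
    using oU Us cV cV0 cW0 chart_open[OF cW] chart_open[OF cW0] by (auto intro!: chart_open_image)
  have s1: "smooth_on (\<phi> ` U) (\<lambda>x. \<phi>0 (inv_into V \<phi> x))"
    using smooth_atlas_transition[OF M V(1) 0(1)] Us by (auto elim!: smooth_on_subset)
  have s2: "smooth_on (\<phi>0 ` U) (\<lambda>x. \<psi>0 (F (inv_into V0 \<phi>0 x)))"
    using s0 Us by (auto elim!: smooth_on_subset)
  have s3: "smooth_on (\<psi>0 ` (W0 \<inter> W)) (\<lambda>x. \<psi> (inv_into W0 \<psi>0 x))"
    using smooth_atlas_transition[OF N 0(2) W(1)] .
  have "smooth_on (\<phi> ` U) (\<lambda>x. \<psi>0 (F (inv_into V0 \<phi>0 (\<phi>0 (inv_into V \<phi> x)))))"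
    by (rule smooth_on_compose[OF o1 o2 _ s1 s2]) (use Us i in \<open>auto simp: subset_eq\<close>)
  then have "smooth_on (\<phi> ` U) (\<lambda>x. \<psi>0 (F (inv_into V \<phi> x)))"
    by (rule smooth_on_cong[OF o1, rotated]) (use Us i in \<open>auto simp: subset_eq\<close>)
  then have "smooth_on (\<phi> ` U) (\<lambda>x. \<psi> (inv_into W0 \<psi>0 (\<psi>0 (F (inv_into V \<phi> x)))))"
    by (rule smooth_on_compose[OF o1 o3 _ _ s3, rotated]) (use Us i in \<open>auto simp: subset_eq\<close>)
  then have "smooth_on (\<phi> ` U) (\<lambda>x. \<psi> (F (inv_into V \<phi> x)))"
    by (rule smooth_on_cong[OF o1, rotated]) (use Us i in \<open>auto simp: subset_eq\<close>)
  moreover have "continuous_map (subtopology (space_of M) U) (space_of N) F"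
    using cont Us by (auto intro: continuous_map_from_subtopology_mono)
  moreover have "p \<in> U" using V W 0 by (auto simp: U_def)
  ultimately show ?thesis using that oU Us by blast
qed

lemma smooth_near_obtain_charts:
  assumes "smooth_near M N p F"
  obtains V \<phi> W \<psi> where "(V, \<phi>) \<in> atlas M" "p \<in> V" "(W, \<psi>) \<in> atlas N" "F p \<in> W"
proof -
  from assms obtain V \<phi> W \<psi> U where "(V, \<phi>) \<in> atlas M" "(W, \<psi>) \<in> atlas N" "p \<in> U" "U \<subseteq> V" "F ` U \<subseteq> W"
    unfolding smooth_near_def by blast
  with that[of V \<phi> W \<psi>] show ?thesis by auto
qed

lemma smooth_near_in_topspace:
  assumes "smooth_atlas M" "smooth_atlas N" "smooth_near M N p F"
  shows "p \<in> topspace (space_of M)" "F p \<in> topspace (space_of N)"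
proof -
  obtain V \<phi> W \<psi> where "(V, \<phi>) \<in> atlas M" "p \<in> V" "(W, \<psi>) \<in> atlas N" "F p \<in> W"
    using smooth_near_obtain_charts[OF assms(3)] .
  then show "p \<in> topspace (space_of M)" "F p \<in> topspace (space_of N)"
    using openin_subset[OF chart_open[OF smooth_atlas_chart[OF assms(1)]]]
      openin_subset[OF chart_open[OF smooth_atlas_chart[OF assms(2)]]] by blast+
qed

lemma smooth_near_neighbourhood:
  assumes M: "smooth_atlas M" and N: "smooth_atlas N" and F: "smooth_near M N p F"
  obtains U where "openin (space_of M) U" "p \<in> U"
    "continuous_map (subtopology (space_of M) U) (space_of N) F"
    "\<forall>q\<in>U. smooth_near M N q F"
proof -
  obtain V \<phi> W \<psi> where VW: "(V, \<phi>) \<in> atlas M" "p \<in> V" "(W, \<psi>) \<in> atlas N" "F p \<in> W"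
    using smooth_near_obtain_charts[OF F] .
  obtain U where U: "openin (space_of M) U" "p \<in> U" "U \<subseteq> V" "F ` U \<subseteq> W"
    "smooth_on (\<phi> ` U) (\<lambda>x. \<psi> (F (inv_into V \<phi> x)))"
    "continuous_map (subtopology (space_of M) U) (space_of N) F"
    using smooth_near_charts[OF M N F VW] .
  then have "smooth_near M N q F" if "q \<in> U" for q
    unfolding smooth_near_def using VW that by blast
  with U show ?thesis using that by blast
qed

lemma smooth_near_cong:
  assumes M: "smooth_atlas M" and N: "smooth_atlas N" and F: "smooth_near M N p F"
    and T: "openin (space_of M) T" "p \<in> T" "\<And>q. q \<in> T \<Longrightarrow> F q = H q"
  shows "smooth_near M N p H"
proof -
  obtain V \<phi> W \<psi> where VW: "(V, \<phi>) \<in> atlas M" "p \<in> V" "(W, \<psi>) \<in> atlas N" "F p \<in> W"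
    using smooth_near_obtain_charts[OF F] .
  obtain U where U: "openin (space_of M) U" "p \<in> U" "U \<subseteq> V" "F ` U \<subseteq> W"
    "smooth_on (\<phi> ` U) (\<lambda>x. \<psi> (F (inv_into V \<phi> x)))"
    using smooth_near_charts[OF M N F VW] .
  note cV = smooth_atlas_chart[OF M VW(1)]
  have o: "openin (space_of M) (U \<inter> T)" using U T by blast
  have "smooth_on (\<phi> ` (U \<inter> T)) (\<lambda>x. \<psi> (F (inv_into V \<phi> x)))"
    using U(5) by (rule smooth_on_subset) auto
  then have "smooth_on (\<phi> ` (U \<inter> T)) (\<lambda>x. \<psi> (H (inv_into V \<phi> x)))"
    by (rule smooth_on_cong[OF chart_open_image[OF cV o], rotated -1])
      (use U T inv_into_f_f[OF chart_inj[OF cV]] in \<open>auto simp: subset_eq\<close>)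
  moreover have "H ` (U \<inter> T) \<subseteq> W" using U T by fastforce
  ultimately show ?thesis unfolding smooth_near_def using VW U T o
    by (intro exI[of _ V] exI[of _ \<phi>] exI[of _ W] exI[of _ \<psi>] exI[of _ "U \<inter> T"]) auto
qed

lemma smooth_map_on_iff_smooth_near:
  assumes M: "smooth_atlas M" and N: "smooth_atlas N"
  shows "smooth_map_on M N U F \<longleftrightarrow> openin (space_of M) U \<and> (\<forall>p\<in>U. smooth_near M N p F)"
proof (intro iffI conjI ballI)
  assume L: "smooth_map_on M N U F"
  then show oU: "openin (space_of M) U" by (simp add: smooth_map_on_def)
  have c: "continuous_map (subtopology (space_of M) U) (space_of N) F"
    using L by (simp add: smooth_map_on_def)
  fix p assume p: "p \<in> U"
  have UT: "U \<subseteq> topspace (space_of M)" using oU openin_subset by blast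
  then have "F p \<in> topspace (space_of N)" using c p by (auto simp: continuous_map_def)
  then obtain W \<psi> where W: "(W, \<psi>) \<in> atlas N" "F p \<in> W" by (rule smooth_atlas_cover[OF N])
  obtain V \<phi> where "(V, \<phi>) \<in> atlas M" "p \<in> V" using smooth_atlas_cover[OF M subsetD[OF UT p]] .
  note VW = this W
  note cV = smooth_atlas_chart[OF M VW(1)] note cW = smooth_atlas_chart[OF N VW(3)]
  have "openin (subtopology (space_of M) U) {q \<in> topspace (subtopology (space_of M) U). F q \<in> W}"
    using c chart_open[OF cW] by (rule openin_continuous_map_preimage)
  then have "openin (space_of M) {q \<in> U. F q \<in> W}"
    using oU UT by (simp add: openin_open_subtopology Int_absorb1)
  then have "openin (space_of M) ({q \<in> U. F q \<in> W} \<inter> V)" using chart_open[OF cV] by blast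
  moreover have "{q \<in> U. F q \<in> W} \<inter> V = {q \<in> U \<inter> V. F q \<in> W}" by auto
  ultimately have o: "openin (space_of M) {q \<in> U \<inter> V. F q \<in> W}" by simp
  have "smooth_on (\<phi> ` {q \<in> U \<inter> V. F q \<in> W}) (\<lambda>x. \<psi> (F (inv_into V \<phi> x)))"
    using L VW by (fastforce simp: smooth_map_on_def comp_def)
  with o VW p show "smooth_near M N p F" unfolding smooth_near_def
    by (intro exI[of _ V] exI[of _ \<phi>] exI[of _ W] exI[of _ \<psi>] exI[of _ "{q \<in> U \<inter> V. F q \<in> W}"]) auto
next
  assume R: "openin (space_of M) U \<and> (\<forall>p\<in>U. smooth_near M N p F)"
  then have oU: "openin (space_of M) U" and n: "\<And>p. p \<in> U \<Longrightarrow> smooth_near M N p F" by auto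
  have UT: "U \<subseteq> topspace (space_of M)" using oU openin_subset by blast
  show "smooth_map_on M N U F" unfolding smooth_map_on_def
  proof (intro conjI)
    show "openin (space_of M) U" by fact
    show "continuous_map (subtopology (space_of M) U) (space_of N) F"
      unfolding continuous_map_def
    proof (intro conjI allI impI)
      show "F \<in> topspace (subtopology (space_of M) U) \<rightarrow> topspace (space_of N)"
        using smooth_near_in_topspace(2)[OF M N n] by (simp add: Pi_iff)
      fix A assume A: "openin (space_of N) A"
      have "\<exists>T. openin (space_of M) T \<and> p \<in> T \<and> T \<subseteq> {q \<in> U. F q \<in> A}"
        if "p \<in> {q \<in> U. F q \<in> A}" for p
      proof -
        have "p \<in> U" using that by simp
        obtain T where T: "openin (space_of M) T" "p \<in> T"
          "continuous_map (subtopology (space_of M) T) (space_of N) F"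
          "\<forall>q\<in>T. smooth_near M N q F"
          using smooth_near_neighbourhood[OF M N n[OF \<open>p \<in> U\<close>]] .
        then have "T \<subseteq> topspace (space_of M)" using openin_subset by blast
        with T openin_continuous_map_preimage[OF T(3) A]
        have "openin (space_of M) {q \<in> T. F q \<in> A}"
          by (simp add: openin_open_subtopology Int_absorb1)
        then have "openin (space_of M) ({q \<in> T. F q \<in> A} \<inter> U)" using oU by blast
        then show ?thesis using T that by (intro exI[of _ "{q \<in> T. F q \<in> A} \<inter> U"]) auto
      qed
      then have "openin (space_of M) {q \<in> U. F q \<in> A}" by (subst openin_subopen) blast
      then show "openin (subtopology (space_of M) U) {q \<in> topspace (subtopology (space_of M) U). F q \<in> A}"
        using oU UT by (simp add: openin_open_subtopology Int_absorb1)
    qed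
    have "smooth_on (\<phi> ` {p \<in> U \<inter> V. F p \<in> W}) (\<lambda>x. \<psi> (F (inv_into V \<phi> x)))"
      if V: "(V, \<phi>) \<in> atlas M" and W: "(W, \<psi>) \<in> atlas N" for V \<phi> W \<psi>
      unfolding smooth_on_def
    proof (intro allI Ck_on_local)
      let ?A = "{p \<in> U \<inter> V. F p \<in> W}"
      fix k x assume "x \<in> \<phi> ` ?A"
      then obtain p where p: "p \<in> U" "p \<in> V" "F p \<in> W" "x = \<phi> p" by auto
      obtain T where T: "openin (space_of M) T" "p \<in> T" "T \<subseteq> V" "F ` T \<subseteq> W"
        "smooth_on (\<phi> ` T) (\<lambda>x. \<psi> (F (inv_into V \<phi> x)))"
        using smooth_near_charts[OF M N n[OF p(1)] V p(2) W p(3)] .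
      then show "\<exists>T. open T \<and> x \<in> T \<and> Ck_on k (\<phi> ` ?A \<inter> T) (\<lambda>x. \<psi> (F (inv_into V \<phi> x)))"
        using chart_open_image[OF smooth_atlas_chart[OF M V] T(1,3)] p
        by (intro exI[of _ "\<phi> ` T"]) (auto simp: smooth_on_def intro: Ck_on_subset)
    qed
    then show "\<forall>(V, \<phi>)\<in>atlas M. \<forall>(W, \<psi>)\<in>atlas N.
        smooth_on (\<phi> ` {p \<in> U \<inter> V. F p \<in> W}) (\<psi> \<circ> F \<circ> inv_into V \<phi>)"
      by (auto simp: comp_def)
  qed
qed


text \<open>The coordinate expressions compose through a chart around \<open>F p\<close>.\<close>

lemma smooth_near_compose:
  assumes M: "smooth_atlas M" and N: "smooth_atlas N" and P: "smooth_atlas P"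
    and F: "smooth_near M N p F" and H: "smooth_near N P (F p) H"
  shows "smooth_near M P p (\<lambda>q. H (F q))"
proof -
  obtain V \<phi> W \<psi> where VW: "(V, \<phi>) \<in> atlas M" "p \<in> V" "(W, \<psi>) \<in> atlas N" "F p \<in> W"
    using smooth_near_obtain_charts[OF F] .
  obtain X \<xi> where X: "(X, \<xi>) \<in> atlas P" "H (F p) \<in> X"
    using smooth_near_obtain_charts[OF H] .
  obtain U where U: "openin (space_of M) U" "p \<in> U" "U \<subseteq> V" "F ` U \<subseteq> W"
    "smooth_on (\<phi> ` U) (\<lambda>x. \<psi> (F (inv_into V \<phi> x)))"
    "continuous_map (subtopology (space_of M) U) (space_of N) F"
    using smooth_near_charts[OF M N F VW] .
  obtain T where T: "openin (space_of N) T" "F p \<in> T" "T \<subseteq> W" "H ` T \<subseteq> X"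
    "smooth_on (\<psi> ` T) (\<lambda>x. \<xi> (H (inv_into W \<psi> x)))"
    using smooth_near_charts[OF N P H VW(3,4) X] .
  note cV = smooth_atlas_chart[OF M VW(1)] note cW = smooth_atlas_chart[OF N VW(3)]
  note i = inv_into_f_f[OF chart_inj[OF cV]] inv_into_f_f[OF chart_inj[OF cW]]
  let ?U = "{q \<in> U. F q \<in> T}"
  have "U \<subseteq> topspace (space_of M)" using U(1) openin_subset by blast
  with U(1) openin_continuous_map_preimage[OF U(6) T(1)]
  have o: "openin (space_of M) ?U" by (simp add: openin_open_subtopology Int_absorb1)
  have oU: "open (\<phi> ` ?U)" and oT: "open (\<psi> ` T)"
    using chart_open_image[OF cV o] chart_open_image[OF cW T(1,3)] U by auto
  have "smooth_on (\<phi> ` ?U) (\<lambda>x. \<psi> (F (inv_into V \<phi> x)))"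
    using U(5) by (rule smooth_on_subset) auto
  then have "smooth_on (\<phi> ` ?U) (\<lambda>x. \<xi> (H (inv_into W \<psi> (\<psi> (F (inv_into V \<phi> x))))))"
    by (rule smooth_on_compose[OF oU oT _ _ T(5), rotated]) (use U T i in \<open>auto simp: subset_eq\<close>)
  then have "smooth_on (\<phi> ` ?U) (\<lambda>x. \<xi> (H (F (inv_into V \<phi> x))))"
    by (rule smooth_on_cong[OF oU, rotated]) (use U T i in \<open>auto simp: subset_eq\<close>)
  then show ?thesis unfolding smooth_near_def using VW X U T o
    by (intro exI[of _ V] exI[of _ \<phi>] exI[of _ X] exI[of _ \<xi>] exI[of _ ?U]) auto
qed

lemma smooth_manifold_imp_smooth_atlas: "smooth_manifold M \<Longrightarrow> smooth_atlas M"
  by (simp add: smooth_manifold_def smooth_atlas_def)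

lemma smooth_atlas_euclidean: "smooth_atlas euclidean_manifold"
proof -
  have "inv_into UNIV (\<lambda>x::'a. x) = (\<lambda>x. x)" by (auto simp: inv_into_def)
  moreover have "homeomorphic_map euclidean euclidean (\<lambda>x::'a. x)"
    using homeomorphic_map_id[of euclidean euclidean] by (simp add: id_def)
  ultimately show ?thesis
    by (simp add: smooth_atlas_def euclidean_manifold_def is_chart_def comp_def
        smooth_on_linear bounded_linear_ident)
qed

lemma smooth_near_euclidean_iff:
  "smooth_near euclidean_manifold euclidean_manifold p f \<longleftrightarrow> (\<exists>S. open S \<and> p \<in> S \<and> smooth_on S f)"
proof -
  have "inv_into UNIV (\<lambda>x::'a. x) = (\<lambda>x. x)" by (auto simp: inv_into_def)
  then show ?thesis
    by (auto simp: smooth_near_def euclidean_manifold_def)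
qed

lemma space_of_prod: "space_of (prod_manifold M N) = prod_topology (space_of M) (space_of N)"
  by (simp add: prod_manifold_def)

lemma atlas_prod: "c \<in> atlas (prod_manifold M N) \<longleftrightarrow>
    (\<exists>V \<phi> W \<psi>. c = (V \<times> W, map_prod \<phi> \<psi>) \<and> (V, \<phi>) \<in> atlas M \<and> (W, \<psi>) \<in> atlas N)"
  by (auto simp: prod_manifold_def)

lemma inv_into_map_prod:
  assumes "inj_on f A" "inj_on g B" "x \<in> f ` A" "y \<in> g ` B"
  shows "inv_into (A \<times> B) (map_prod f g) (x, y) = (inv_into A f x, inv_into B g y)"
proof -
  have "inj_on (map_prod f g) (A \<times> B)" using assms by (auto intro: map_prod_inj_on)
  moreover have "map_prod f g (inv_into A f x, inv_into B g y) = (x, y)"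
    using assms by (simp add: f_inv_into_f)
  moreover have "(inv_into A f x, inv_into B g y) \<in> A \<times> B"
    using assms by (simp add: inv_into_into)
  ultimately show ?thesis by (metis inv_into_f_f)
qed

lemma homeomorphic_map_prod:
  assumes "homeomorphic_map X X' f" "homeomorphic_map Y Y' g"
  shows "homeomorphic_map (prod_topology X Y) (prod_topology X' Y') (map_prod f g)"
proof -
  obtain f' g' where "homeomorphic_maps X X' f f'" "homeomorphic_maps Y Y' g g'"
    using assms by (auto simp: homeomorphic_map_maps)
  then have "homeomorphic_maps (prod_topology X Y) (prod_topology X' Y')
      (\<lambda>(x,y). (f x, g y)) (\<lambda>(x,y). (f' x, g' y))"
    by (simp add: homeomorphic_maps_prod)
  then show ?thesis unfolding homeomorphic_map_maps map_prod_def by blast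
qed

text \<open>Transition maps of product charts are products of transition maps.\<close>

lemma smooth_atlas_prod:
  assumes M: "smooth_atlas M" and N: "smooth_atlas N"
  shows "smooth_atlas (prod_manifold M N)"
  unfolding smooth_atlas_def
proof (intro conjI)
  have "is_chart (space_of (prod_manifold M N)) c" if "c \<in> atlas (prod_manifold M N)" for c
  proof -
    from that obtain V \<phi> W \<psi> where c: "c = (V \<times> W, map_prod \<phi> \<psi>)" and V: "(V, \<phi>) \<in> atlas M" and W: "(W, \<psi>) \<in> atlas N"
      by (auto simp: atlas_prod)
    note cV = smooth_atlas_chart[OF M V] note cW = smooth_atlas_chart[OF N W]
    have i: "map_prod \<phi> \<psi> ` (V \<times> W) = \<phi> ` V \<times> \<psi> ` W" by (simp add: map_prod_surj_on)
    have "homeomorphic_map (prod_topology (subtopology (space_of M) V) (subtopology (space_of N) W))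
       (prod_topology (top_of_set (\<phi> ` V)) (top_of_set (\<psi> ` W))) (map_prod \<phi> \<psi>)"
      using cV cW by (intro homeomorphic_map_prod) (auto simp: is_chart_def)
    then have "homeomorphic_map (subtopology (space_of (prod_manifold M N)) (V \<times> W))
       (top_of_set (\<phi> ` V \<times> \<psi> ` W)) (map_prod \<phi> \<psi>)"
      by (simp add: space_of_prod subtopology_Times[symmetric] euclidean_product_topology)
    then show ?thesis
      using cV cW by (auto simp: is_chart_def c i space_of_prod openin_prod_Times_iff open_Times)
  qed
  then show "\<forall>c\<in>atlas (prod_manifold M N). is_chart (space_of (prod_manifold M N)) c" by blast
next
  show "(\<Union>(V, \<phi>)\<in>atlas (prod_manifold M N). V) = topspace (space_of (prod_manifold M N))"
  proof (intro equalityI subsetI)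
    fix z assume "z \<in> (\<Union>(V, \<phi>)\<in>atlas (prod_manifold M N). V)"
    then obtain V \<phi> W \<psi> where V: "(V, \<phi>) \<in> atlas M" and W: "(W, \<psi>) \<in> atlas N" and z: "z \<in> V \<times> W"
      by (fastforce simp: atlas_prod)
    have "V \<subseteq> topspace (space_of M)" "W \<subseteq> topspace (space_of N)"
      using openin_subset[OF chart_open[OF smooth_atlas_chart[OF M V]]]
        openin_subset[OF chart_open[OF smooth_atlas_chart[OF N W]]] .
    with z show "z \<in> topspace (space_of (prod_manifold M N))" by (auto simp: space_of_prod)
  next
    fix z assume "z \<in> topspace (space_of (prod_manifold M N))"
    then obtain x y where z: "z = (x, y)" "x \<in> topspace (space_of M)" "y \<in> topspace (space_of N)"
      by (auto simp: space_of_prod)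
    obtain V \<phi> where V: "(V, \<phi>) \<in> atlas M" "x \<in> V" using smooth_atlas_cover[OF M z(2)] .
    obtain W \<psi> where W: "(W, \<psi>) \<in> atlas N" "y \<in> W" using smooth_atlas_cover[OF N z(3)] .
    have "(V \<times> W, map_prod \<phi> \<psi>) \<in> atlas (prod_manifold M N)" using V W atlas_prod by blast
    then show "z \<in> (\<Union>(V, \<phi>)\<in>atlas (prod_manifold M N). V)" using V W z by blast
  qed
next
  have "smooth_on (map_prod \<phi> \<psi> ` (V \<times> W \<inter> V' \<times> W')) (\<lambda>x. map_prod \<phi>' \<psi>' (inv_into (V \<times> W) (map_prod \<phi> \<psi>) x))"
    if V: "(V, \<phi>) \<in> atlas M" and W: "(W, \<psi>) \<in> atlas N"
      and V': "(V', \<phi>') \<in> atlas M" and W': "(W', \<psi>') \<in> atlas N" for V \<phi> W \<psi> V' \<phi>' W' \<psi>'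
  proof -
    note cV = smooth_atlas_chart[OF M V] note cW = smooth_atlas_chart[OF N W]
    note cV' = smooth_atlas_chart[OF M V'] note cW' = smooth_atlas_chart[OF N W']
    have e: "map_prod \<phi> \<psi> ` (V \<times> W \<inter> V' \<times> W') = \<phi> ` (V \<inter> V') \<times> \<psi> ` (W \<inter> W')"
      by (simp add: Times_Int_Times map_prod_surj_on)
    have oV: "open (\<phi> ` (V \<inter> V'))" and oW: "open (\<psi> ` (W \<inter> W'))"
      using chart_open_image[OF cV, of "V \<inter> V'"] chart_open_image[OF cW, of "W \<inter> W'"]
        chart_open[OF cV] chart_open[OF cW] chart_open[OF cV'] chart_open[OF cW'] by auto
    then have o: "open (\<phi> ` (V \<inter> V') \<times> \<psi> ` (W \<inter> W'))" by (rule open_Times)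
    have "smooth_on (\<phi> ` (V \<inter> V') \<times> \<psi> ` (W \<inter> W'))
        (\<lambda>z. (\<phi>' (inv_into V \<phi> (fst z)), \<psi>' (inv_into W \<psi> (snd z))))"
      by (intro smooth_on_Pair[OF o]
          smooth_on_compose[OF o oV _ smooth_on_linear[OF bounded_linear_fst] smooth_atlas_transition[OF M V V']]
          smooth_on_compose[OF o oW _ smooth_on_linear[OF bounded_linear_snd] smooth_atlas_transition[OF N W W']])
        auto
    then have "smooth_on (\<phi> ` (V \<inter> V') \<times> \<psi> ` (W \<inter> W'))
        (\<lambda>x. map_prod \<phi>' \<psi>' (inv_into (V \<times> W) (map_prod \<phi> \<psi>) x))"
      by (rule smooth_on_cong[OF o, rotated])
        (auto simp: inv_into_map_prod[OF chart_inj[OF cV] chart_inj[OF cW]])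
    then show ?thesis by (simp only: e)
  qed
  then show "\<forall>(V, \<phi>)\<in>atlas (prod_manifold M N). \<forall>(W, \<psi>)\<in>atlas (prod_manifold M N).
      smooth_on (\<phi> ` (V \<inter> W)) (\<psi> \<circ> inv_into V \<phi>)"
    by (auto simp: atlas_prod comp_def)
qed

lemma smooth_near_Pair:
  assumes M: "smooth_atlas M" and N: "smooth_atlas N" and P: "smooth_atlas P"
    and F: "smooth_near M N p F" and H: "smooth_near M P p H"
  shows "smooth_near M (prod_manifold N P) p (\<lambda>q. (F q, H q))"
proof -
  obtain V \<phi> W \<psi> where VW: "(V, \<phi>) \<in> atlas M" "p \<in> V" "(W, \<psi>) \<in> atlas N" "F p \<in> W"
    using smooth_near_obtain_charts[OF F] .
  obtain X \<xi> where X: "(X, \<xi>) \<in> atlas P" "H p \<in> X"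
    using smooth_near_obtain_charts[OF H] .
  obtain U where U: "openin (space_of M) U" "p \<in> U" "U \<subseteq> V" "F ` U \<subseteq> W"
    "smooth_on (\<phi> ` U) (\<lambda>x. \<psi> (F (inv_into V \<phi> x)))"
    using smooth_near_charts[OF M N F VW] .
  obtain T where T: "openin (space_of M) T" "p \<in> T" "T \<subseteq> V" "H ` T \<subseteq> X"
    "smooth_on (\<phi> ` T) (\<lambda>x. \<xi> (H (inv_into V \<phi> x)))"
    using smooth_near_charts[OF M P H VW(1,2) X] .
  have o: "openin (space_of M) (U \<inter> T)" using U T by blast
  have oe: "open (\<phi> ` (U \<inter> T))"
    using chart_open_image[OF smooth_atlas_chart[OF M VW(1)] o] U by auto
  have "smooth_on (\<phi> ` (U \<inter> T)) (\<lambda>x. (\<psi> (F (inv_into V \<phi> x)), \<xi> (H (inv_into V \<phi> x))))"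
    by (intro smooth_on_Pair[OF oe] smooth_on_subset[OF U(5)] smooth_on_subset[OF T(5)]) auto
  then show ?thesis unfolding smooth_near_def using VW X U T o
    by (intro exI[of _ V] exI[of _ \<phi>] exI[of _ "W \<times> X"] exI[of _ "map_prod \<psi> \<xi>"] exI[of _ "U \<inter> T"])
      (auto simp: atlas_prod)
qed

lemma smooth_near_ident:
  assumes M: "smooth_atlas M" and p: "p \<in> topspace (space_of M)"
  shows "smooth_near M M p (\<lambda>q. q)"
proof -
  obtain V \<phi> where V: "(V, \<phi>) \<in> atlas M" "p \<in> V" using smooth_atlas_cover[OF M p] .
  note cV = smooth_atlas_chart[OF M V(1)]
  have "smooth_on (\<phi> ` V) (\<lambda>x. \<phi> (inv_into V \<phi> x))"
    using smooth_atlas_transition[OF M V(1) V(1)] by simp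
  then show ?thesis unfolding smooth_near_def using V chart_open[OF cV]
    by (intro exI[of _ V] exI[of _ \<phi>] exI[of _ V] exI[of _ \<phi>] exI[of _ V]) auto
qed

lemma smooth_near_const:
  assumes M: "smooth_atlas M" and N: "smooth_atlas N"
    and p: "p \<in> topspace (space_of M)" and c: "c \<in> topspace (space_of N)"
  shows "smooth_near M N p (\<lambda>q. c)"
proof -
  obtain V \<phi> where V: "(V, \<phi>) \<in> atlas M" "p \<in> V" using smooth_atlas_cover[OF M p] .
  obtain W \<psi> where W: "(W, \<psi>) \<in> atlas N" "c \<in> W" using smooth_atlas_cover[OF N c] .
  show ?thesis unfolding smooth_near_def
    using V W chart_open[OF smooth_atlas_chart[OF M V(1)]]
    by (intro exI[of _ V] exI[of _ \<phi>] exI[of _ W] exI[of _ \<psi>] exI[of _ V]) (auto simp: smooth_on_const)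
qed

lemma smooth_near_chart:
  assumes M: "smooth_atlas M" and V: "(V, \<phi>) \<in> atlas M" and p: "p \<in> V"
  shows "smooth_near M euclidean_manifold p \<phi>"
proof -
  have "smooth_on (\<phi> ` V) (\<lambda>x. \<phi> (inv_into V \<phi> x))"
    using smooth_atlas_transition[OF M V V] by simp
  then show ?thesis unfolding smooth_near_def using V p chart_open[OF smooth_atlas_chart[OF M V]]
    by (intro exI[of _ V] exI[of _ \<phi>] exI[of _ UNIV] exI[of _ "\<lambda>x. x"] exI[of _ V])
      (auto simp: euclidean_manifold_def)
qed

lemma smooth_near_chart_inv:
  assumes M: "smooth_atlas M" and V: "(V, \<phi>) \<in> atlas M" and y: "y \<in> \<phi> ` V"
  shows "smooth_near euclidean_manifold M y (inv_into V \<phi>)"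
proof -
  note cV = smooth_atlas_chart[OF M V]
  have i: "inv_into UNIV (\<lambda>x::'b. x) = (\<lambda>x. x)" by (auto simp: inv_into_def)
  have "smooth_on (\<phi> ` V) (\<lambda>x. \<phi> (inv_into V \<phi> x))"
    using smooth_atlas_transition[OF M V V] by simp
  then show ?thesis unfolding smooth_near_def using V y cV
    by (intro exI[of _ UNIV] exI[of _ "\<lambda>x. x"] exI[of _ V] exI[of _ \<phi>] exI[of _ "\<phi> ` V"])
      (auto simp: euclidean_manifold_def i is_chart_def inv_into_into)
qed

section \<open>Calculus of germs between Euclidean spaces\<close>

abbreviation smooth_germ :: "'e::euclidean_space \<Rightarrow> ('e \<Rightarrow> 'f::euclidean_space) \<Rightarrow> bool" where
  "smooth_germ z f \<equiv> smooth_near euclidean_manifold euclidean_manifold z f"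

abbreviation deriv_at :: "('a::real_normed_vector \<Rightarrow> 'b::real_normed_vector) \<Rightarrow> 'a \<Rightarrow> 'a \<Rightarrow> 'b" where
  "deriv_at f z \<equiv> frechet_derivative f (at z)"

lemma smooth_germE:
  assumes "smooth_germ z f"
  obtains S where "open S" "z \<in> S" "smooth_on S f"
  using assms smooth_near_euclidean_iff by blast

lemma smooth_germI: "open S \<Longrightarrow> z \<in> S \<Longrightarrow> smooth_on S f \<Longrightarrow> smooth_germ z f"
  using smooth_near_euclidean_iff by blast

lemma smooth_germ_has_derivative: "smooth_germ z f \<Longrightarrow> (f has_derivative deriv_at f z) (at z)"
  by (erule smooth_germE) (rule smooth_on_has_derivative)

lemma smooth_germ_linear_deriv: "smooth_germ z f \<Longrightarrow> linear (deriv_at f z)"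
  using smooth_germ_has_derivative has_derivative_linear by blast

lemma smooth_germ_deriv: "smooth_germ z f \<Longrightarrow> smooth_germ z (\<lambda>y. deriv_at f y q)"
  by (erule smooth_germE) (rule smooth_germI, auto intro: smooth_on_frechet_derivative)

lemma smooth_germ_has_second_derivative:
  "smooth_germ z f \<Longrightarrow> ((\<lambda>y. deriv_at f y q) has_derivative (\<lambda>p. second_derivative f z p q)) (at z)"
  by (erule smooth_germE) (rule smooth_on_has_second_derivative)

lemma deriv_at_eqI: "(f has_derivative f') (at z) \<Longrightarrow> deriv_at f z = f'"
  by (rule frechet_derivative_at[symmetric])

lemma smooth_germ_linear: "bounded_linear L \<Longrightarrow> smooth_germ z L"
  by (rule smooth_germI[of UNIV]) (auto intro: smooth_on_linear)

lemma smooth_germ_const: "smooth_germ z (\<lambda>x. c)"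
  by (rule smooth_germI[of UNIV]) (auto intro: smooth_on_const)

lemma smooth_germ_Pair:
  assumes "smooth_germ z f" "smooth_germ z g" shows "smooth_germ z (\<lambda>x. (f x, g x))"
proof -
  obtain S where S: "open S" "z \<in> S" "smooth_on S f" using assms(1) by (rule smooth_germE)
  obtain T where T: "open T" "z \<in> T" "smooth_on T g" using assms(2) by (rule smooth_germE)
  have "smooth_on (S \<inter> T) (\<lambda>x. (f x, g x))"
    using S T by (intro smooth_on_Pair) (auto intro: smooth_on_subset)
  then show ?thesis using S T by (intro smooth_germI[of "S \<inter> T"]) auto
qed

lemmas smooth_germ_compose = smooth_near_compose[OF smooth_atlas_euclidean smooth_atlas_euclidean smooth_atlas_euclidean]

lemma space_of_euclidean: "space_of euclidean_manifold = euclidean"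
  by (simp add: euclidean_manifold_def)

lemma deriv_at_cong:
  assumes "smooth_germ z f" "open T" "z \<in> T" "\<And>x. x \<in> T \<Longrightarrow> f x = g x"
  shows "deriv_at g z = deriv_at f z"
  by (rule deriv_at_eqI)
    (rule has_derivative_transform_within_open[OF smooth_germ_has_derivative[OF assms(1)] assms(2-4)])

lemma second_derivative_cong:
  assumes f: "smooth_germ z f" and T: "open T" "z \<in> T" "\<And>x. x \<in> T \<Longrightarrow> f x = g x"
  shows "second_derivative g z p q = second_derivative f z p q"
proof -
  obtain S where S: "open S" "z \<in> S" "smooth_on S f" using f by (rule smooth_germE)
  have "deriv_at f y = deriv_at g y" if "y \<in> S \<inter> T" for y
    by (rule deriv_at_cong[symmetric, OF smooth_germI[of S] T(1)]) (use that S T in auto)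
  then have "((\<lambda>y. deriv_at g y q) has_derivative (\<lambda>p. second_derivative f z p q)) (at z)"
    using S T by (intro has_derivative_transform_within_open[OF smooth_germ_has_second_derivative[OF f],
          of "S \<inter> T"]) auto
  then show ?thesis by (simp add: second_derivative_def[of g] deriv_at_eqI)
qed

lemma deriv_at_compose:
  assumes "smooth_germ z f" "smooth_germ (f z) g"
  shows "deriv_at (\<lambda>x. g (f x)) z p = deriv_at g (f z) (deriv_at f z p)"
  using deriv_at_eqI[OF has_derivative_compose[OF smooth_germ_has_derivative[OF assms(1)]
        smooth_germ_has_derivative[OF assms(2)]]] by simp

lemma second_derivative_germ_compose:
  assumes f: "smooth_germ z f" and g: "smooth_germ (f z) g"
  shows "second_derivative (\<lambda>x. g (f x)) z p q =
    second_derivative g (f z) (deriv_at f z p) (deriv_at f z q)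
    + deriv_at g (f z) (second_derivative f z p q)"
proof -
  obtain S where S: "open S" "z \<in> S" "smooth_on S f" using f by (rule smooth_germE)
  obtain T where T: "open T" "f z \<in> T" "smooth_on T g" using g by (rule smooth_germE)
  have "open (S \<inter> f -` T)"
    using S T smooth_on_imp_continuous_on by (metis continuous_open_preimage)
  then show ?thesis
    by (rule second_derivative_compose[OF _ T(1) _ _ T(3)]) (use S T in \<open>auto intro: smooth_on_subset\<close>)
qed

lemma second_derivative_germ_symmetric:
  "smooth_germ z f \<Longrightarrow> second_derivative f z p q = second_derivative f z q p"
  by (erule smooth_germE) (rule second_derivative_symmetric)

lemma second_derivative_zero_left: "smooth_germ z f \<Longrightarrow> second_derivative f z 0 q = 0"
  using linear_0[OF has_derivative_linear[OF smooth_germ_has_second_derivative]] by blast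

lemma second_derivative_linear_map: "bounded_linear L \<Longrightarrow> second_derivative L z p q = 0"
  by (simp add: second_derivative_def deriv_at_eqI[OF bounded_linear_imp_has_derivative])

lemma deriv_at_linear_map: "bounded_linear L \<Longrightarrow> deriv_at L z = L"
  by (simp add: deriv_at_eqI[OF bounded_linear_imp_has_derivative])

lemma deriv_at_Pair:
  assumes "smooth_germ z f" "smooth_germ z g"
  shows "deriv_at (\<lambda>x. (f x, g x)) z p = (deriv_at f z p, deriv_at g z p)"
  using deriv_at_eqI[OF has_derivative_Pair[OF smooth_germ_has_derivative[OF assms(1)]
        smooth_germ_has_derivative[OF assms(2)]]] by simp

lemma second_derivative_Pair:
  assumes f: "smooth_germ z f" and g: "smooth_germ z g"
  shows "second_derivative (\<lambda>x. (f x, g x)) z p q = (second_derivative f z p q, second_derivative g z p q)"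
proof -
  obtain S where S: "open S" "z \<in> S" "smooth_on S f" using f by (rule smooth_germE)
  obtain T where T: "open T" "z \<in> T" "smooth_on T g" using g by (rule smooth_germE)
  have "(deriv_at f y q, deriv_at g y q) = deriv_at (\<lambda>x. (f x, g x)) y q" if "y \<in> S \<inter> T" for y
    using that S T by (intro deriv_at_Pair[symmetric] smooth_germI) auto
  then have "((\<lambda>y. deriv_at (\<lambda>x. (f x, g x)) y q) has_derivative
      (\<lambda>p. (second_derivative f z p q, second_derivative g z p q))) (at z)"
    using S T by (intro has_derivative_transform_within_open[OF has_derivative_Pair[OF
            smooth_germ_has_second_derivative[OF f] smooth_germ_has_second_derivative[OF g]], of "S \<inter> T"]) auto
  then show ?thesis by (simp add: second_derivative_def[of "\<lambda>x. (f x, g x)"] deriv_at_eqI)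
qed

lemma smooth_germ_left_slice: "smooth_germ a (\<lambda>x. (x, b))" for a :: "'e::euclidean_space" and b :: "'f::euclidean_space"
  by (intro smooth_germ_Pair smooth_germ_const smooth_germ_linear bounded_linear_ident)

lemma smooth_germ_right_slice: "smooth_germ b (\<lambda>y. (a, y))" for a :: "'e::euclidean_space" and b :: "'f::euclidean_space"
  by (intro smooth_germ_Pair smooth_germ_const smooth_germ_linear bounded_linear_ident)

lemma deriv_at_left_slice:
  assumes "smooth_germ (a, b) F"
  shows "deriv_at (\<lambda>x. F (x, b)) a u = deriv_at F (a, b) (u, 0)"
  using deriv_at_compose[OF smooth_germ_left_slice assms]
    deriv_at_eqI[OF has_derivative_Pair[OF has_derivative_ident has_derivative_const], of b a]
  by simp

lemma deriv_at_right_slice: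
  assumes "smooth_germ (a, b) F"
  shows "deriv_at (\<lambda>y. F (a, y)) b v = deriv_at F (a, b) (0, v)"
  using deriv_at_compose[OF smooth_germ_right_slice assms]
    deriv_at_eqI[OF has_derivative_Pair[OF has_derivative_const has_derivative_ident], of a b]
  by simp

text \<open>The form in which second derivatives occur below: a partial derivative in the second variable is
  differentiated in the first.\<close>

lemma mixed_second_derivative:
  assumes F: "smooth_germ (a, b) F"
  shows "((\<lambda>x. deriv_at (\<lambda>y. F (x, y)) b v) has_derivative
      (\<lambda>u. second_derivative F (a, b) (u, 0) (0, v))) (at a)"
proof -
  obtain S where S: "open S" "(a, b) \<in> S" "smooth_on S F" using F by (rule smooth_germE)
  have "((\<lambda>x. (x, b)) has_derivative (\<lambda>u. (u, 0))) (at a)"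
    by (auto intro!: derivative_eq_intros)
  from has_derivative_compose[OF this smooth_germ_has_second_derivative[OF F]]
  have "((\<lambda>x. deriv_at F (x, b) (0, v)) has_derivative
      (\<lambda>u. second_derivative F (a, b) (u, 0) (0, v))) (at a)" .
  moreover have "open ((\<lambda>x. (x, b)) -` S)"
    using S(1) by (intro continuous_open_vimage) (auto intro!: continuous_intros)
  ultimately show ?thesis
    using S by (elim has_derivative_transform_within_open)
      (auto simp: deriv_at_right_slice[OF smooth_germI[of S]])
qed

lemma smooth_at_iff_smooth_near:
  assumes M: "smooth_atlas M"
  shows "smooth_at M p f \<longleftrightarrow> smooth_near M euclidean_manifold p f"
proof
  assume "smooth_at M p f"
  then show "smooth_near M euclidean_manifold p f"
    by (auto simp: smooth_at_def smooth_map_on_iff_smooth_near[OF M smooth_atlas_euclidean])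
next
  assume "smooth_near M euclidean_manifold p f"
  then obtain U where "openin (space_of M) U" "p \<in> U"
    "continuous_map (subtopology (space_of M) U) (space_of euclidean_manifold) f"
    "\<forall>q\<in>U. smooth_near M euclidean_manifold q f"
    by (rule smooth_near_neighbourhood[OF M smooth_atlas_euclidean])
  then show "smooth_at M p f"
    by (auto simp: smooth_at_def smooth_map_on_iff_smooth_near[OF M smooth_atlas_euclidean])
qed

section \<open>Lie groups in a chart around the unit\<close>

text \<open>All computations take place in one chart around the unit. The element with coordinates \<open>a\<close> is
  \<open>point a\<close>, which is meaningful for \<open>a\<close> in the open set \<open>\<phi> ` V\<close> only.\<close>

locale charted_lie_group = group G
  for G :: "('a, 'm) monoid_scheme" (structure) +
  fixes M :: "('a, 'e::euclidean_space) manifold" and V :: "'a set" and \<phi> :: "'a \<Rightarrow> 'e"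
  assumes lie_group: "lie_group G M"
    and chart_at_one: "(V, \<phi>) \<in> atlas M" "\<one> \<in> V"
begin

abbreviation point :: "'e \<Rightarrow> 'a" where "point \<equiv> inv_into V \<phi>"
abbreviation origin :: 'e where "origin \<equiv> \<phi> \<one>"

lemma atlasM: "smooth_atlas M"
  using lie_group by (simp add: lie_group_def smooth_manifold_imp_smooth_atlas)

lemma topspaceM: "topspace (space_of M) = carrier G"
  using lie_group by (simp add: lie_group_def)

lemma is_chartV: "is_chart (space_of M) (V, \<phi>)"
  using smooth_atlas_chart[OF atlasM chart_at_one(1)] .

lemma V_carrier: "x \<in> V \<Longrightarrow> x \<in> carrier G"
  using openin_subset[OF chart_open[OF is_chartV]] topspaceM by auto

lemma point_\<phi>: "x \<in> V \<Longrightarrow> point (\<phi> x) = x"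
  using chart_inj[OF is_chartV] by simp

lemma point_origin [simp]: "point origin = \<one>"
  using point_\<phi> chart_at_one by simp

lemma \<phi>_point: "a \<in> \<phi> ` V \<Longrightarrow> \<phi> (point a) = a"
  by (rule f_inv_into_f)

lemma point_in_V: "a \<in> \<phi> ` V \<Longrightarrow> point a \<in> V"
  by (rule inv_into_into)

lemma point_carrier: "a \<in> \<phi> ` V \<Longrightarrow> point a \<in> carrier G"
  using point_in_V V_carrier by blast

lemma origin_in: "origin \<in> \<phi> ` V"
  using chart_at_one by simp

lemma open_\<phi>V: "open (\<phi> ` V)"
  using is_chartV by (simp add: is_chart_def)

lemma near_mult:
  assumes N: "smooth_atlas N" and f: "smooth_near N M p f" and g: "smooth_near N M p g"
  shows "smooth_near N M p (\<lambda>q. f q \<otimes> g q)"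
proof -
  have P: "smooth_atlas (prod_manifold M M)" by (intro smooth_atlas_prod atlasM)
  have "smooth_map (prod_manifold M M) M (\<lambda>(x, y). x \<otimes> y)"
    using lie_group by (simp add: lie_group_def)
  moreover have "(f p, g p) \<in> topspace (space_of (prod_manifold M M))"
    using smooth_near_in_topspace(2)[OF N atlasM f] smooth_near_in_topspace(2)[OF N atlasM g]
    by (simp add: space_of_prod)
  ultimately have "smooth_near (prod_manifold M M) M (f p, g p) (\<lambda>(x, y). x \<otimes> y)"
    by (simp add: smooth_map_on_iff_smooth_near[OF P atlasM])
  from smooth_near_compose[OF N P atlasM smooth_near_Pair[OF N atlasM atlasM f g] this]
  show ?thesis by simp
qed

lemma near_inv:
  assumes N: "smooth_atlas N" and f: "smooth_near N M p f"
  shows "smooth_near N M p (\<lambda>q. inv (f q))"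
proof -
  have "smooth_map M M (\<lambda>x. inv x)"
    using lie_group unfolding lie_group_def by blast
  then have "smooth_near M M (f p) (\<lambda>x. inv x)"
    using smooth_near_in_topspace(2)[OF N atlasM f]
    by (simp add: smooth_map_on_iff_smooth_near[OF atlasM atlasM])
  from smooth_near_compose[OF N atlasM atlasM f this] show ?thesis .
qed

lemma near_point:
  assumes N: "smooth_atlas N" and f: "smooth_near N euclidean_manifold p f" and p: "f p \<in> \<phi> ` V"
  shows "smooth_near N M p (\<lambda>q. point (f q))"
  by (rule smooth_near_compose[OF N smooth_atlas_euclidean atlasM f
        smooth_near_chart_inv[OF atlasM chart_at_one(1) p]])

lemma near_\<phi>:
  assumes N: "smooth_atlas N" and f: "smooth_near N M p f" and p: "f p \<in> V"
  shows "smooth_near N euclidean_manifold p (\<lambda>q. \<phi> (f q))"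
  by (rule smooth_near_compose[OF N atlasM smooth_atlas_euclidean f
        smooth_near_chart[OF atlasM chart_at_one(1) p]])

lemma near_const:
  assumes "smooth_atlas N" "p \<in> topspace (space_of N)" "c \<in> carrier G"
  shows "smooth_near N M p (\<lambda>q. c)"
  using smooth_near_const[OF assms(1) atlasM assms(2)] assms(3) by (simp add: topspaceM)

lemmas eu_near_mult = near_mult[OF smooth_atlas_euclidean]
lemmas eu_near_inv = near_inv[OF smooth_atlas_euclidean]
lemmas eu_near_point = near_point[OF smooth_atlas_euclidean]
lemmas eu_near_\<phi> = near_\<phi>[OF smooth_atlas_euclidean]

lemma eu_near_const: "c \<in> carrier G \<Longrightarrow> smooth_near euclidean_manifold M z (\<lambda>q. c)"
  by (rule near_const[OF smooth_atlas_euclidean]) (auto simp: space_of_euclidean)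

lemmas eu_near_intros = eu_near_mult eu_near_inv eu_near_point eu_near_const
  smooth_germ_linear bounded_linear_ident bounded_linear_fst bounded_linear_snd

lemma eu_near_map:
  "smooth_near euclidean_manifold M z F \<Longrightarrow> smooth_near M euclidean_manifold (F z) f \<Longrightarrow>
    smooth_germ z (\<lambda>x. f (F x))"
  by (rule smooth_near_compose[OF smooth_atlas_euclidean atlasM smooth_atlas_euclidean])

text \<open>Provides the neighbourhoods on which the chart may be applied to a product of group elements.\<close>

lemma eu_near_open:
  assumes F: "smooth_near euclidean_manifold M z F" and W: "openin (space_of M) W" "F z \<in> W"
  obtains T where "open T" "z \<in> T" "\<And>x. x \<in> T \<Longrightarrow> F x \<in> W"
proof -
  obtain U where U: "openin (space_of euclidean_manifold) U" "z \<in> U"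
    "continuous_map (subtopology (space_of euclidean_manifold) U) (space_of M) F"
    "\<forall>q\<in>U. smooth_near euclidean_manifold M q F"
    using smooth_near_neighbourhood[OF smooth_atlas_euclidean atlasM F] .
  then have "openin (top_of_set U) {x \<in> U. F x \<in> W}" "open U"
    using openin_continuous_map_preimage[OF U(3) W(1)] by (auto simp: space_of_euclidean)
  then have "open {x \<in> U. F x \<in> W}" by (simp add: openin_open_eq)
  then show ?thesis using U W by (intro that[of "{x \<in> U. F x \<in> W}"]) auto
qed

lemma left_translation_near:
  assumes "g \<in> carrier G" "p \<in> carrier G" shows "smooth_near M M p (\<lambda>q. g \<otimes> q)"
  using assms by (intro near_mult near_const atlasM smooth_near_ident) (auto simp: topspaceM)

section \<open>Left-invariant vector fields\<close>

text \<open>The left-invariant field with value \<open>v\<close> at the unit: its vector at \<open>p\<close> is the velocity of the line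
  through \<open>origin\<close> in direction \<open>v\<close>, translated by \<open>p\<close>. Outside the group a vector field is 0 by
  convention.\<close>

definition left_field :: "'e \<Rightarrow> 'a \<Rightarrow> 'a tangent_vector" where
  "left_field v p = (if p \<in> carrier G then velocity M (\<lambda>t. p \<otimes> point (origin + t *\<^sub>R v)) else (\<lambda>f. 0))"

lemma left_field_eq_deriv:
  assumes p: "p \<in> carrier G" and f: "smooth_near M euclidean_manifold p f"
  shows "left_field v p f = deriv_at (\<lambda>b. f (p \<otimes> point b)) origin v"
proof -
  have s: "smooth_germ origin (\<lambda>b. f (p \<otimes> point b))"
    by (rule eu_near_map) (use p f origin_in in \<open>auto intro!: eu_near_intros\<close>)
  have "((\<lambda>t. origin + t *\<^sub>R v) has_derivative (\<lambda>t. t *\<^sub>R v)) (at 0)"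
    by (auto intro!: derivative_eq_intros)
  from has_derivative_compose[OF this, of "\<lambda>b. f (p \<otimes> point b)"] smooth_germ_has_derivative[OF s]
  have "((\<lambda>t. f (p \<otimes> point (origin + t *\<^sub>R v))) has_derivative
     (\<lambda>t. deriv_at (\<lambda>b. f (p \<otimes> point b)) origin (t *\<^sub>R v))) (at 0)" by simp
  then have "DERIV (\<lambda>t. f (p \<otimes> point (origin + t *\<^sub>R v))) 0 :> deriv_at (\<lambda>b. f (p \<otimes> point b)) origin v"
    using linear_scale[OF smooth_germ_linear_deriv[OF s]]
    by (simp add: has_field_derivative_def mult_commute_abs)
  then show ?thesis using p f
    by (simp add: left_field_def velocity_def smooth_at_iff_smooth_near[OF atlasM] DERIV_imp_deriv)
qed

lemma left_field_not_smooth: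
  "\<not> smooth_near M euclidean_manifold p f \<Longrightarrow> left_field v p f = 0"
  by (simp add: left_field_def velocity_def smooth_at_iff_smooth_near[OF atlasM])

text \<open>With a second chart \<open>\<psi>\<close> around \<open>p\<close>, the function \<open>q \<mapsto> left_field v q f\<close> is a partial derivative of the
  smooth function \<open>F (a, b) = f (\<psi>\<inverse> a \<otimes> point b)\<close>, taken at the points \<open>(\<psi> q, origin)\<close>.\<close>

lemma left_field_smooth:
  assumes f: "smooth_near M euclidean_manifold p f"
  shows "smooth_near M euclidean_manifold p (\<lambda>q. left_field v q f)"
proof -
  have p: "p \<in> carrier G" using smooth_near_in_topspace(1)[OF atlasM smooth_atlas_euclidean f] topspaceM by simp
  obtain W \<psi> where W: "(W, \<psi>) \<in> atlas M" "p \<in> W" using smooth_near_obtain_charts[OF f] by metis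
  note cW = smooth_atlas_chart[OF atlasM W(1)]
  obtain U where U: "openin (space_of M) U" "p \<in> U"
    "continuous_map (subtopology (space_of M) U) (space_of euclidean_manifold) f"
    "\<forall>q\<in>U. smooth_near M euclidean_manifold q f"
    using smooth_near_neighbourhood[OF atlasM smooth_atlas_euclidean f] .
  define F where "F z = f (inv_into W \<psi> (fst z) \<otimes> point (snd z))" for z
  have F: "smooth_germ (\<psi> q, origin) F" if "q \<in> U" "q \<in> W" for q
    unfolding F_def
  proof (rule eu_near_map)
    have q: "inv_into W \<psi> (\<psi> q) = q" using chart_inj[OF cW] that by simp
    have "q \<in> carrier G" using that U openin_subset topspaceM by blast
    then show "smooth_near M euclidean_manifold (inv_into W \<psi> (fst (\<psi> q, origin)) \<otimes> point (snd (\<psi> q, origin))) f"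
      using q that U by simp
    have "smooth_near euclidean_manifold M (\<psi> q, origin) (\<lambda>z. inv_into W \<psi> (fst z))"
      by (rule smooth_near_compose[OF smooth_atlas_euclidean smooth_atlas_euclidean atlasM
            smooth_germ_linear[OF bounded_linear_fst] smooth_near_chart_inv[OF atlasM W(1)]])
        (use that in auto)
    then show "smooth_near euclidean_manifold M (\<psi> q, origin) (\<lambda>z. inv_into W \<psi> (fst z) \<otimes> point (snd z))"
      using origin_in by (auto intro!: eu_near_intros)
  qed
  have eq: "deriv_at F (\<psi> q, origin) (0, v) = left_field v q f" if "q \<in> U \<inter> W" for q
  proof -
    have q: "inv_into W \<psi> (\<psi> q) = q" using chart_inj[OF cW] that by simp
    have "q \<in> carrier G" using that U openin_subset topspaceM by blast
    then show ?thesis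
      using deriv_at_right_slice[OF F, of q v] left_field_eq_deriv[of q f v] that U q
      by (simp add: F_def)
  qed
  have "smooth_near M euclidean_manifold p (\<lambda>q. \<psi> q)"
    by (rule smooth_near_chart[OF atlasM W])
  then have "smooth_near M euclidean_manifold p (\<lambda>q. (\<psi> q, origin))"
    by (rule smooth_near_compose[OF atlasM smooth_atlas_euclidean smooth_atlas_euclidean])
      (rule smooth_germ_left_slice)
  then have "smooth_near M euclidean_manifold p (\<lambda>q. deriv_at F (\<psi> q, origin) (0, v))"
    by (rule smooth_near_compose[OF atlasM smooth_atlas_euclidean smooth_atlas_euclidean])
      (use U W F in \<open>blast intro: smooth_germ_deriv\<close>)
  then show ?thesis
    by (rule smooth_near_cong[OF atlasM smooth_atlas_euclidean, of _ _ "U \<inter> W"])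
      (use U W chart_open[OF cW] eq in auto)
qed

lemma left_field_tangent:
  assumes p: "p \<in> carrier G" shows "left_field v p \<in> tangent_space M p"
proof -
  have "open ((\<lambda>t. origin + t *\<^sub>R v) -` (\<phi> ` V))"
    using open_\<phi>V by (intro continuous_open_vimage) (auto intro!: continuous_intros)
  moreover have "0 \<in> (\<lambda>t. origin + t *\<^sub>R v) -` (\<phi> ` V)" using origin_in by simp
  ultimately obtain \<epsilon> where \<epsilon>: "\<epsilon> > 0" "\<And>t. dist t 0 < \<epsilon> \<Longrightarrow> t \<in> (\<lambda>t. origin + t *\<^sub>R v) -` (\<phi> ` V)"
    unfolding open_dist by blast
  have "smooth_near euclidean_manifold M t (\<lambda>t. p \<otimes> point (origin + t *\<^sub>R v))" if "t \<in> {-\<epsilon><..<\<epsilon>}" for t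
  proof -
    have "smooth_germ t (\<lambda>t. origin + t *\<^sub>R v)"
      by (rule smooth_germI[of UNIV])
        (auto simp: smooth_on_def intro!: Ck_on_add Ck_on_const Ck_on_linear[OF bounded_linear_scaleR_left])
    then show ?thesis using p \<epsilon>(2)[of t] that
      by (intro eu_near_mult eu_near_const eu_near_point) auto
  qed
  then have "smooth_map_on euclidean_manifold M {-\<epsilon><..<\<epsilon>} (\<lambda>t. p \<otimes> point (origin + t *\<^sub>R v))"
    by (simp add: smooth_map_on_iff_smooth_near[OF smooth_atlas_euclidean atlasM] space_of_euclidean)
  then show ?thesis
    using p \<epsilon>(1) unfolding tangent_space_def left_field_def
    by (auto intro!: exI[of _ "\<lambda>t. p \<otimes> point (origin + t *\<^sub>R v)"] exI[of _ \<epsilon>])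
qed

lemma left_field_invariant:
  assumes g: "g \<in> carrier G" and p: "p \<in> carrier G"
  shows "left_field v (g \<otimes> p) = differential M (\<lambda>q. g \<otimes> q) p (left_field v p)"
proof
  fix h
  show "left_field v (g \<otimes> p) h = differential M (\<lambda>q. g \<otimes> q) p (left_field v p) h"
  proof (cases "smooth_near M euclidean_manifold (g \<otimes> p) h")
    case True
    have 1: "smooth_near M euclidean_manifold p (\<lambda>q. h (g \<otimes> q))"
      using smooth_near_compose[OF atlasM atlasM smooth_atlas_euclidean left_translation_near[OF g p] True] .
    have "deriv_at (\<lambda>b. h (g \<otimes> p \<otimes> point b)) origin = deriv_at (\<lambda>b. h (g \<otimes> (p \<otimes> point b))) origin"
    proof (rule deriv_at_cong[OF _ open_\<phi>V origin_in])
      show "smooth_germ origin (\<lambda>b. h (g \<otimes> (p \<otimes> point b)))"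
        by (rule eu_near_map) (use g p True origin_in in \<open>auto intro!: eu_near_intros simp: m_assoc\<close>)
    qed (use g p point_carrier m_assoc in auto)
    then show ?thesis using True g p 1
      by (simp add: differential_def smooth_at_iff_smooth_near[OF atlasM] left_field_eq_deriv comp_def)
  next
    case False
    then show ?thesis
      by (simp add: differential_def smooth_at_iff_smooth_near[OF atlasM] left_field_not_smooth)
  qed
qed

lemma left_field_in_lie_algebra: "left_field v \<in> lie_algebra G M"
  unfolding lie_algebra_def vector_field_def
  using left_field_tangent left_field_invariant left_field_smooth
  by (auto simp: topspaceM smooth_at_iff_smooth_near[OF atlasM]) (simp add: left_field_def)

section \<open>The second-order part of the multiplication\<close>

definition chart_mult :: "'e \<times> 'e \<Rightarrow> 'e" where
  "chart_mult z = \<phi> (point (fst z) \<otimes> point (snd z))"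

text \<open>Since \<open>chart_mult (a, origin) = a\<close> and \<open>chart_mult (origin, b) = b\<close> near the origin, this bilinear map
  is the whole second-order part of the multiplication at the unit.\<close>

definition mixed_mult :: "'e \<Rightarrow> 'e \<Rightarrow> 'e" where
  "mixed_mult u v = second_derivative chart_mult (origin, origin) (u, 0) (0, v)"

text \<open>By \<open>bracket_left_fields\<close> this is the Lie bracket, read off at the unit.\<close>

definition lie_bracket :: "'e \<Rightarrow> 'e \<Rightarrow> 'e" where
  "lie_bracket u v = mixed_mult u v - mixed_mult v u"

lemma chart_mult_near: "smooth_near euclidean_manifold M (origin, origin) (\<lambda>z. point (fst z) \<otimes> point (snd z))"
  using origin_in by (auto intro!: eu_near_intros)

lemma chart_mult_germ: "smooth_germ (origin, origin) chart_mult"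
  unfolding chart_mult_def by (rule eu_near_\<phi>[OF chart_mult_near]) (use chart_at_one in auto)

lemma chart_mult_origin [simp]: "chart_mult (origin, origin) = origin"
  by (simp add: chart_mult_def)

lemma deriv_chart_mult_left: "deriv_at chart_mult (origin, origin) (u, 0) = u"
proof -
  have "deriv_at (\<lambda>x. chart_mult (x, origin)) origin = deriv_at (\<lambda>x. x) origin"
    by (rule deriv_at_cong[OF smooth_germ_linear[OF bounded_linear_ident] open_\<phi>V origin_in])
      (simp add: chart_mult_def point_carrier \<phi>_point)
  then show ?thesis
    using deriv_at_left_slice[OF chart_mult_germ, of u] by simp
qed

lemma deriv_chart_mult_right: "deriv_at chart_mult (origin, origin) (0, v) = v"
proof -
  have "deriv_at (\<lambda>x. chart_mult (origin, x)) origin = deriv_at (\<lambda>x. x) origin"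
    by (rule deriv_at_cong[OF smooth_germ_linear[OF bounded_linear_ident] open_\<phi>V origin_in])
      (simp add: chart_mult_def point_carrier \<phi>_point)
  then show ?thesis
    using deriv_at_right_slice[OF chart_mult_germ, of v] by simp
qed

lemma deriv_chart_mult: "deriv_at chart_mult (origin, origin) (u, v) = u + v"
  using linear_add[OF smooth_germ_linear_deriv[OF chart_mult_germ], of "(u, 0)" "(0, v)"]
  by (simp add: deriv_chart_mult_left deriv_chart_mult_right)

text \<open>Symmetry of second derivatives lets the two factors be differentiated in either order.\<close>

lemma second_derivative_chart_mult_flip:
  "second_derivative chart_mult (origin, origin) (0, u) (v, 0) = mixed_mult v u"
  by (simp add: mixed_mult_def second_derivative_germ_symmetric[OF chart_mult_germ, of "(0, u)"])

section \<open>The bracket and the inner product in coordinates\<close>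

lemma left_field_one:
  assumes f: "smooth_near M euclidean_manifold \<one> f"
  shows "left_field v \<one> f = deriv_at (\<lambda>b. f (point b)) origin v"
proof -
  have "smooth_germ origin (\<lambda>b. f (point b))"
    by (rule eu_near_map) (use f origin_in in \<open>auto intro!: eu_near_intros\<close>)
  then have "deriv_at (\<lambda>b. f (\<one> \<otimes> point b)) origin = deriv_at (\<lambda>b. f (point b)) origin"
    by (rule deriv_at_cong[OF _ open_\<phi>V origin_in]) (simp add: point_carrier)
  then show ?thesis using left_field_eq_deriv[OF _ f] by simp
qed

text \<open>The left-hand side is a mixed derivative of \<open>f (point a \<otimes> point b)\<close>, that is, of \<open>f \<circ> point\<close> composed
  with \<open>chart_mult\<close>, and the right-hand side is the second-order chain rule for this composition.\<close>

lemma left_field_iterated: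
  assumes f: "smooth_near M euclidean_manifold \<one> f"
  shows "left_field u \<one> (\<lambda>q. left_field v q f) =
    second_derivative (\<lambda>b. f (point b)) origin u v + deriv_at (\<lambda>b. f (point b)) origin (mixed_mult u v)"
proof -
  let ?f = "\<lambda>b. f (point b)"
  define F where "F z = f (point (fst z) \<otimes> point (snd z))" for z
  have gf: "smooth_germ origin ?f"
    by (rule eu_near_map) (use f origin_in in \<open>auto intro!: eu_near_intros\<close>)
  have gF: "smooth_germ (origin, origin) F"
    unfolding F_def by (rule eu_near_map[OF chart_mult_near]) (use f in auto)
  obtain U where U: "openin (space_of M) U" "\<one> \<in> U"
    "continuous_map (subtopology (space_of M) U) (space_of euclidean_manifold) f"
    "\<forall>q\<in>U. smooth_near M euclidean_manifold q f"
    using smooth_near_neighbourhood[OF atlasM smooth_atlas_euclidean f] .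
  have "smooth_near euclidean_manifold M origin point"
    using origin_in by (auto intro!: eu_near_intros)
  then obtain T where T: "open T" "origin \<in> T" "\<And>x. x \<in> T \<Longrightarrow> point x \<in> U"
    by (rule eu_near_open[OF _ U(1)]) (use U in auto)
  have "((\<lambda>a. deriv_at (\<lambda>b. F (a, b)) origin v) has_derivative
      (\<lambda>u. second_derivative F (origin, origin) (u, 0) (0, v))) (at origin)"
    by (rule mixed_second_derivative[OF gF])
  then have "((\<lambda>a. left_field v (point a) f) has_derivative
      (\<lambda>u. second_derivative F (origin, origin) (u, 0) (0, v))) (at origin)"
    by (rule has_derivative_transform_within_open[of _ _ _ _ "T \<inter> \<phi> ` V"])
      (use T U open_\<phi>V origin_in point_carrier in \<open>auto simp: F_def left_field_eq_deriv\<close>)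
  then have "left_field u \<one> (\<lambda>q. left_field v q f) = second_derivative F (origin, origin) (u, 0) (0, v)"
    using left_field_one[OF left_field_smooth[OF f]] by (simp add: deriv_at_eqI)
  also have "\<dots> = second_derivative (\<lambda>z. ?f (chart_mult z)) (origin, origin) (u, 0) (0, v)"
  proof -
    obtain S where S: "open S" "(origin, origin) \<in> S" "\<And>z. z \<in> S \<Longrightarrow> point (fst z) \<otimes> point (snd z) \<in> V"
      by (rule eu_near_open[OF chart_mult_near chart_open[OF is_chartV]]) (use chart_at_one in auto)
    have "smooth_germ (origin, origin) (\<lambda>z. ?f (chart_mult z))"
      by (rule smooth_germ_compose[OF chart_mult_germ]) (simp add: gf)
    then show ?thesis
      by (rule second_derivative_cong[OF _ S(1,2)]) (use S point_\<phi> in \<open>simp add: chart_mult_def F_def\<close>)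
  qed
  also have "\<dots> = second_derivative ?f origin u v + deriv_at ?f origin (mixed_mult u v)"
    using second_derivative_germ_compose[OF chart_mult_germ, of ?f "(u, 0)" "(0, v)"] gf
    by (simp add: deriv_chart_mult_left deriv_chart_mult_right mixed_mult_def)
  finally show ?thesis .
qed

text \<open>In the difference of the two iterated derivatives the second derivatives of \<open>f \<circ> point\<close> cancel by
  symmetry.\<close>

lemma bracket_left_fields:
  "bracket M (left_field u) (left_field v) \<one> = left_field (lie_bracket u v) \<one>"
proof
  fix f
  show "bracket M (left_field u) (left_field v) \<one> f = left_field (lie_bracket u v) \<one> f"
  proof (cases "smooth_near M euclidean_manifold \<one> f")
    case True
    have gf: "smooth_germ origin (\<lambda>b. f (point b))"
      by (rule eu_near_map) (use True origin_in in \<open>auto intro!: eu_near_intros\<close>)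
    show ?thesis
      using True linear_diff[OF smooth_germ_linear_deriv[OF gf]]
        second_derivative_germ_symmetric[OF gf, of u v]
      by (simp add: bracket_def smooth_at_iff_smooth_near[OF atlasM] left_field_iterated
          left_field_one[OF True] lie_bracket_def)
  next
    case False
    then show ?thesis
      by (simp add: bracket_def smooth_at_iff_smooth_near[OF atlasM] left_field_not_smooth)
  qed
qed

lemma left_field_one_linear:
  "left_field (a *\<^sub>R u + b *\<^sub>R v) \<one> = (\<lambda>f. a * left_field u \<one> f + b * left_field v \<one> f)"
proof
  fix f
  show "left_field (a *\<^sub>R u + b *\<^sub>R v) \<one> f = a * left_field u \<one> f + b * left_field v \<one> f"
  proof (cases "smooth_near M euclidean_manifold \<one> f")
    case True
    have gf: "smooth_germ origin (\<lambda>b. f (point b))"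
      by (rule eu_near_map) (use True origin_in in \<open>auto intro!: eu_near_intros\<close>)
    show ?thesis
      using smooth_germ_linear_deriv[OF gf]
      by (simp add: left_field_one[OF True] linear_add linear_scale)
  qed (simp add: left_field_not_smooth)
qed

text \<open>The linear coordinate \<open>q \<mapsto> \<phi> q \<bullet> v\<close> has derivative \<open>v \<bullet> v\<close> along the field.\<close>

lemma left_field_one_nonzero:
  assumes "v \<noteq> 0" shows "left_field v \<one> \<noteq> (\<lambda>f. 0)"
proof
  assume 0: "left_field v \<one> = (\<lambda>f. 0)"
  have s: "smooth_near M euclidean_manifold \<one> (\<lambda>q. \<phi> q \<bullet> v)"
    by (rule smooth_near_compose[OF atlasM smooth_atlas_euclidean smooth_atlas_euclidean
          smooth_near_chart[OF atlasM chart_at_one] smooth_germ_linear[OF bounded_linear_inner_left]])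
  have "deriv_at (\<lambda>b. \<phi> (point b) \<bullet> v) origin = deriv_at (\<lambda>b. b \<bullet> v) origin"
    by (rule deriv_at_cong[OF smooth_germ_linear[OF bounded_linear_inner_left] open_\<phi>V origin_in])
      (simp add: \<phi>_point)
  also have "\<dots> = (\<lambda>b. b \<bullet> v)" by (rule deriv_at_linear_map[OF bounded_linear_inner_left])
  finally have "left_field v \<one> (\<lambda>q. \<phi> q \<bullet> v) = v \<bullet> v"
    using left_field_one[OF s] by simp
  with 0 assms show False by simp
qed

text \<open>The inner product on the coordinate space obtained from the metric at the unit.\<close>

definition inner_at_one ::
  "('a \<Rightarrow> 'a tangent_vector \<Rightarrow> 'a tangent_vector \<Rightarrow> real) \<Rightarrow> 'e \<Rightarrow> 'e \<Rightarrow> real" where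
  "inner_at_one m u v = m \<one> (left_field u \<one>) (left_field v \<one>)"

lemma inner_at_one_commute:
  "riemannian_metric M m \<Longrightarrow> inner_at_one m u v = inner_at_one m v u"
  using left_field_tangent by (auto simp: inner_at_one_def riemannian_metric_def topspaceM)

lemma inner_at_one_linear_left:
  assumes "riemannian_metric M m"
  shows "inner_at_one m (a *\<^sub>R u + b *\<^sub>R v) w = a * inner_at_one m u w + b * inner_at_one m v w"
  using assms left_field_tangent[OF one_closed]
  by (simp add: inner_at_one_def riemannian_metric_def topspaceM left_field_one_linear)

lemma inner_at_one_pos:
  assumes "riemannian_metric M m" "u \<noteq> 0" shows "inner_at_one m u u > 0"
  using assms left_field_tangent[OF one_closed] left_field_one_nonzero[OF assms(2)]
  by (simp add: inner_at_one_def riemannian_metric_def topspaceM)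

lemma inner_at_one_linear_right:
  assumes m: "riemannian_metric M m" shows "linear (inner_at_one m w)"
proof
  fix u v :: 'e and r :: real
  show "inner_at_one m w (u + v) = inner_at_one m w u + inner_at_one m w v"
    using inner_at_one_linear_left[OF m, of 1 u 1 v w] by (simp add: inner_at_one_commute[OF m, of w])
  show "inner_at_one m w (r *\<^sub>R u) = r *\<^sub>R inner_at_one m w u"
    using inner_at_one_linear_left[OF m, of r u 0 u w] by (simp add: inner_at_one_commute[OF m, of w])
qed

lemma inner_at_one_cyclic:
  assumes "cyclic_metric G M m"
  shows "inner_at_one m (lie_bracket u v) w + inner_at_one m (lie_bracket v w) u
    + inner_at_one m (lie_bracket w u) v = 0"
  using assms left_field_in_lie_algebra
  unfolding cyclic_metric_def lie_algebra_inner_def inner_at_one_def bracket_left_fields[symmetric]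
  by blast

section \<open>The adjoint action\<close>

text \<open>The differential at the unit of the conjugation by \<open>x\<close>.\<close>

definition Ad :: "'a \<Rightarrow> 'e \<Rightarrow> 'e" where
  "Ad x v = deriv_at (\<lambda>b. \<phi> (x \<otimes> point b \<otimes> inv x)) origin v"

lemma conj_near:
  assumes "x \<in> carrier G"
  shows "smooth_near euclidean_manifold M origin (\<lambda>b. x \<otimes> point b \<otimes> inv x)"
  using assms origin_in by (auto intro!: eu_near_intros)

lemma conj_germ:
  assumes "x \<in> carrier G"
  shows "smooth_germ origin (\<lambda>b. \<phi> (x \<otimes> point b \<otimes> inv x))"
  by (rule eu_near_\<phi>[OF conj_near[OF assms]]) (use assms chart_at_one in auto)

lemma Ad_mult:
  assumes x: "x \<in> carrier G" and y: "y \<in> carrier G"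
  shows "Ad (x \<otimes> y) v = Ad x (Ad y v)"
proof -
  let ?c = "\<lambda>x b. \<phi> (x \<otimes> point b \<otimes> inv x)"
  obtain S where S: "open S" "origin \<in> S" "\<And>b. b \<in> S \<Longrightarrow> y \<otimes> point b \<otimes> inv y \<in> V"
    by (rule eu_near_open[OF conj_near[OF y] chart_open[OF is_chartV]]) (use chart_at_one y in auto)
  have co: "?c y origin = origin" using y by simp
  have g: "smooth_germ origin (\<lambda>b. ?c x (?c y b))"
    by (rule smooth_germ_compose[OF conj_germ[OF y]]) (use conj_germ[OF x] co in simp)
  have "deriv_at (?c (x \<otimes> y)) origin = deriv_at (\<lambda>b. ?c x (?c y b)) origin"
  proof (rule deriv_at_cong[OF g, of "S \<inter> \<phi> ` V"])
    fix b assume b: "b \<in> S \<inter> \<phi> ` V"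
    have "point b \<in> carrier G" using b point_carrier by blast
    with b show "?c x (?c y b) = ?c (x \<otimes> y) b"
      using x y point_\<phi>[OF S(3)[of b]] by (simp add: m_assoc inv_mult_group)
  qed (use S open_\<phi>V origin_in in auto)
  then have "deriv_at (?c (x \<otimes> y)) origin v = deriv_at (\<lambda>b. ?c x (?c y b)) origin v" by simp
  also have "\<dots> = deriv_at (?c x) (?c y origin) (deriv_at (?c y) origin v)"
    by (rule deriv_at_compose[OF conj_germ[OF y]]) (use conj_germ[OF x] co in simp)
  finally show ?thesis unfolding Ad_def co .
qed

lemma Ad_one: "Ad \<one> v = v"
proof -
  have "deriv_at (\<lambda>b. \<phi> (\<one> \<otimes> point b \<otimes> inv \<one>)) origin = deriv_at (\<lambda>b. b) origin"
    by (rule deriv_at_cong[OF smooth_germ_linear[OF bounded_linear_ident] open_\<phi>V origin_in])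
      (simp add: point_carrier \<phi>_point)
  then show ?thesis by (simp add: Ad_def)
qed

text \<open>Let \<open>K (a, b)\<close> be the coordinates of the conjugate of \<open>point b\<close> by \<open>point a\<close>. Taking the mixed
  derivative of \<open>chart_mult (K (a, b), a) = chart_mult (a, b)\<close> gives
  \<open>mixed_mult v u + D\<^sup>2K (u, v) = mixed_mult u v\<close>, because \<open>K (a, origin) = origin\<close> and
  \<open>K (origin, b) = b\<close>.\<close>

lemma Ad_has_derivative:
  "((\<lambda>a. Ad (point a) v) has_derivative (\<lambda>u. lie_bracket u v)) (at origin)"
proof -
  define K where "K z = \<phi> (point (fst z) \<otimes> point (snd z) \<otimes> inv (point (fst z)))" for z
  let ?o = "(origin, origin)"
  have nK: "smooth_near euclidean_manifold M ?o (\<lambda>z. point (fst z) \<otimes> point (snd z) \<otimes> inv (point (fst z)))"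
    using origin_in by (auto intro!: eu_near_intros)
  have gK: "smooth_germ ?o K"
    unfolding K_def by (rule eu_near_\<phi>[OF nK]) (use chart_at_one in auto)
  have Ko: "K ?o = origin" by (simp add: K_def)
  have DK1: "deriv_at K ?o (u, 0) = 0" for u
  proof -
    have "deriv_at (\<lambda>a. K (a, origin)) origin = deriv_at (\<lambda>a. origin) origin"
      by (rule deriv_at_cong[OF smooth_germ_const open_\<phi>V origin_in]) (simp add: K_def point_carrier)
    then show ?thesis using deriv_at_left_slice[OF gK, of u] by simp
  qed
  have DK2: "deriv_at K ?o (0, v) = v" for v
    using deriv_at_right_slice[OF gK, of v] Ad_one[of v] by (simp add: K_def Ad_def)
  let ?h = "\<lambda>z. (K z, fst z)"
  have gh: "smooth_germ ?o ?h"
    by (intro smooth_germ_Pair gK smooth_germ_linear bounded_linear_fst)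
  have Dh: "deriv_at ?h ?o p = (deriv_at K ?o p, fst p)" for p
    by (simp add: deriv_at_Pair[OF gK smooth_germ_linear[OF bounded_linear_fst]]
        deriv_at_linear_map[OF bounded_linear_fst])
  have dh: "second_derivative ?h ?o p q = (second_derivative K ?o p q, 0)" for p q
    by (simp add: second_derivative_Pair[OF gK smooth_germ_linear[OF bounded_linear_fst]]
        second_derivative_linear_map[OF bounded_linear_fst])
  have d2K: "second_derivative K ?o (u, 0) (0, v) = lie_bracket u v" for u
  proof -
    obtain S where S: "open S" "?o \<in> S"
      "\<And>z. z \<in> S \<Longrightarrow> point (fst z) \<otimes> point (snd z) \<otimes> inv (point (fst z)) \<in> V"
      by (rule eu_near_open[OF nK chart_open[OF is_chartV]]) (use chart_at_one in auto)
    have "second_derivative (\<lambda>z. chart_mult (?h z)) ?o (u, 0) (0, v) = second_derivative chart_mult ?o (u, 0) (0, v)"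
    proof (rule second_derivative_cong[OF chart_mult_germ, of "S \<inter> \<phi> ` V \<times> \<phi> ` V"])
      fix z assume z: "z \<in> S \<inter> \<phi> ` V \<times> \<phi> ` V"
      then have "point (fst z) \<in> carrier G" "point (snd z) \<in> carrier G" by (auto simp: point_carrier)
      then show "chart_mult z = chart_mult (?h z)"
        using z point_\<phi>[OF S(3)[of z]] by (simp add: chart_mult_def K_def m_assoc)
    qed (use S open_\<phi>V origin_in in \<open>auto intro!: open_Times\<close>)
    moreover have "second_derivative (\<lambda>z. chart_mult (?h z)) ?o (u, 0) (0, v)
       = second_derivative chart_mult ?o (0, u) (v, 0) + deriv_at chart_mult ?o (second_derivative K ?o (u, 0) (0, v), 0)"
      using second_derivative_germ_compose[OF gh, of chart_mult "(u, 0)" "(0, v)"] chart_mult_germ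
      by (simp add: Ko Dh dh DK1 DK2)
    ultimately show ?thesis
      by (simp add: second_derivative_chart_mult_flip deriv_chart_mult_left lie_bracket_def mixed_mult_def
          eq_diff_eq add.commute)
  qed
  have "((\<lambda>a. deriv_at (\<lambda>b. K (a, b)) origin v) has_derivative
      (\<lambda>u. second_derivative K ?o (u, 0) (0, v))) (at origin)"
    by (rule mixed_second_derivative[OF gK])
  then show ?thesis by (simp add: K_def Ad_def d2K)
qed

text \<open>Take the mixed derivative of \<open>chart_mult (a, k b) = chart_mult (k b, a)\<close>. Thus the tangent vectors at
  the unit of curves of central elements are central in the Lie algebra.\<close>

lemma lie_bracket_central_velocity:
  assumes k: "smooth_germ origin k" "k origin = origin"
    and T: "open T" "origin \<in> T"
    and central: "\<And>b g. b \<in> T \<Longrightarrow> g \<in> carrier G \<Longrightarrow> g \<otimes> point (k b) = point (k b) \<otimes> g"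
  shows "lie_bracket u (deriv_at k origin v) = 0" "lie_bracket (deriv_at k origin v) u = 0"
proof -
  let ?o = "(origin, origin)" and ?k = "\<lambda>z. k (snd z)" and ?w = "deriv_at k origin v"
  have gf: "smooth_germ ?o fst" by (intro smooth_germ_linear bounded_linear_fst)
  have gs: "smooth_germ ?o snd" by (intro smooth_germ_linear bounded_linear_snd)
  have gk: "smooth_germ ?o ?k" by (rule smooth_germ_compose[OF gs]) (simp add: k)
  have Dk: "deriv_at ?k ?o p = deriv_at k origin (snd p)" for p
    using deriv_at_compose[OF gs, of k p] k by (simp add: deriv_at_linear_map[OF bounded_linear_snd])
  have dk: "second_derivative ?k ?o (u, 0) (0, v) = 0"
    using second_derivative_germ_compose[OF gs, of k "(u, 0)" "(0, v)"] k
    by (simp add: deriv_at_linear_map[OF bounded_linear_snd] second_derivative_linear_map[OF bounded_linear_snd]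
        second_derivative_zero_left linear_0[OF smooth_germ_linear_deriv])
  note D0 = linear_0[OF smooth_germ_linear_deriv[OF k(1)]]
  note M0 = linear_0[OF smooth_germ_linear_deriv[OF chart_mult_germ]]
  note d0 = second_derivative_linear_map[OF bounded_linear_fst]
  have g1: "smooth_germ ?o (\<lambda>z. (fst z, ?k z))" and g2: "smooth_germ ?o (\<lambda>z. (?k z, fst z))"
    by (intro smooth_germ_Pair gf gk)+
  have gm: "smooth_germ ?o (\<lambda>z. chart_mult (fst z, ?k z))"
    by (rule smooth_germ_compose[OF g1]) (simp add: k chart_mult_germ)
  have "second_derivative (\<lambda>z. chart_mult (?k z, fst z)) ?o (u, 0) (0, v)
      = second_derivative (\<lambda>z. chart_mult (fst z, ?k z)) ?o (u, 0) (0, v)"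
    by (rule second_derivative_cong[OF gm, of "\<phi> ` V \<times> T"])
      (use T open_\<phi>V origin_in central in \<open>auto intro!: open_Times simp: chart_mult_def point_carrier\<close>)
  moreover have "second_derivative (\<lambda>z. chart_mult (fst z, ?k z)) ?o (u, 0) (0, v) = mixed_mult u ?w"
    using second_derivative_germ_compose[OF g1, of chart_mult "(u, 0)" "(0, v)"] chart_mult_germ k
    by (simp add: deriv_at_Pair[OF gf gk] second_derivative_Pair[OF gf gk] Dk dk D0 M0 d0 zero_prod_def[symmetric]
        deriv_at_linear_map[OF bounded_linear_fst] mixed_mult_def)
  moreover have "second_derivative (\<lambda>z. chart_mult (?k z, fst z)) ?o (u, 0) (0, v) = mixed_mult ?w u"
    using second_derivative_germ_compose[OF g2, of chart_mult "(u, 0)" "(0, v)"] chart_mult_germ k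
    by (simp add: deriv_at_Pair[OF gk gf] second_derivative_Pair[OF gk gf] Dk dk D0 M0 d0 zero_prod_def[symmetric]
        deriv_at_linear_map[OF bounded_linear_fst] second_derivative_chart_mult_flip)
  ultimately show "lie_bracket u ?w = 0" "lie_bracket ?w u = 0"
    by (simp_all add: lie_bracket_def)
qed

section \<open>Functions with vanishing derivative on a connected group\<close>

text \<open>A subgroup that contains a neighbourhood of the unit is open, and so are its cosets, hence its
  complement.\<close>

lemma connected_open_subgroup:
  assumes conn: "connected_space (space_of M)"
    and S: "subgroup S G" and U: "openin (space_of M) U" "\<one> \<in> U" "U \<subseteq> S"
  shows "S = carrier G"
proof -
  have pre: "openin (space_of M) {y \<in> carrier G. inv x \<otimes> y \<in> U}" if x: "x \<in> carrier G" for x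
  proof -
    have "smooth_map M M (\<lambda>q. inv x \<otimes> q)"
      using left_translation_near[of "inv x"] x
        openin_topspace[of "space_of M"]
      by (auto simp: smooth_map_on_iff_smooth_near[OF atlasM atlasM] topspaceM)
    then have "continuous_map (space_of M) (space_of M) (\<lambda>q. inv x \<otimes> q)"
      by (simp add: smooth_map_on_def)
    from openin_continuous_map_preimage[OF this U(1)] show ?thesis by (simp add: topspaceM)
  qed
  have SG: "S \<subseteq> carrier G" using S subgroup.subset by blast
  have in_S: "x \<in> S \<longleftrightarrow> y \<in> S" if "x \<in> carrier G" "y \<in> carrier G" "inv x \<otimes> y \<in> U" for x y
  proof -
    have u: "inv x \<otimes> y \<in> S" using that U by blast
    have "y = x \<otimes> (inv x \<otimes> y)" "x = y \<otimes> inv (inv x \<otimes> y)"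
      using that by (simp_all add: m_assoc[symmetric] inv_mult_group)
    then show ?thesis using u S by (metis subgroup.m_closed subgroup.m_inv_closed)
  qed
  have nb: "x \<in> {y \<in> carrier G. inv x \<otimes> y \<in> U}" if "x \<in> carrier G" for x using that U by simp
  have "openin (space_of M) S"
  proof (subst openin_subopen, intro ballI)
    fix x assume "x \<in> S"
    then show "\<exists>T. openin (space_of M) T \<and> x \<in> T \<and> T \<subseteq> S"
      using pre[of x] nb[of x] in_S[of x] SG by (intro exI[of _ "{y \<in> carrier G. inv x \<otimes> y \<in> U}"]) auto
  qed
  moreover have "openin (space_of M) (carrier G - S)"
  proof (subst openin_subopen, intro ballI)
    fix x assume "x \<in> carrier G - S"
    then show "\<exists>T. openin (space_of M) T \<and> x \<in> T \<and> T \<subseteq> carrier G - S"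
      using pre[of x] nb[of x] in_S[of x] by (intro exI[of _ "{y \<in> carrier G. inv x \<otimes> y \<in> U}"]) auto
  qed
  ultimately have "S = {} \<or> S = carrier G"
    using conn SG unfolding connected_space_clopen_in closedin_def topspaceM by blast
  then show ?thesis using subgroup.one_closed[OF S] by blast
qed

lemma openin_point_ball: "openin (space_of M) {x \<in> V. \<phi> x \<in> ball origin r}"
proof -
  have "openin (subtopology (space_of M) V) {x \<in> topspace (subtopology (space_of M) V). \<phi> x \<in> ball origin r}"
    by (rule openin_continuous_map_preimage[OF chart_continuous[OF is_chartV]]) simp
  moreover have "topspace (subtopology (space_of M) V) = V" using V_carrier topspaceM by auto
  ultimately show ?thesis
    using chart_open[OF is_chartV] by (simp only: openin_open_subtopology)
qed

text \<open>The hypothesis differentiates at the unit only, but for all right translates of \<open>H\<close>, and every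
  point near the unit becomes the unit after a right translation. So \<open>H\<close> is unchanged by left
  multiplication with the elements of a coordinate ball. The elements with this property form a
  subgroup, which is the whole group by connectedness.\<close>

lemma constant_if_derivative_zero:
  fixes H :: "'a \<Rightarrow> 'b::real_normed_vector"
  assumes conn: "connected_space (space_of M)"
    and H: "\<And>p. p \<in> carrier G \<Longrightarrow> ((\<lambda>a. H (point a \<otimes> p)) has_derivative (\<lambda>u. 0)) (at origin)"
    and x: "x \<in> carrier G"
  shows "H x = H \<one>"
proof -
  obtain r where r: "r > 0" "ball origin r \<subseteq> \<phi> ` V"
    using open_\<phi>V origin_in open_contains_ball by blast
  have D: "((\<lambda>a. H (point a \<otimes> p)) has_derivative (\<lambda>u. 0)) (at a0)"
    if p: "p \<in> carrier G" and a0: "a0 \<in> \<phi> ` V" for p a0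
  proof -
    have c0: "point a0 \<in> carrier G" using point_carrier a0 by blast
    \<comment> \<open>this right translation carries \<open>point a0\<close> to the unit, where the hypothesis applies\<close>
    let ?t = "\<lambda>a. point a \<otimes> inv (point a0)"
    have n: "smooth_near euclidean_manifold M a0 ?t"
      using a0 c0 by (auto intro!: eu_near_intros)
    have t0: "?t a0 = \<one>" using c0 by simp
    have g: "smooth_germ a0 (\<lambda>a. \<phi> (?t a))" by (rule eu_near_\<phi>[OF n]) (use t0 chart_at_one in simp)
    obtain S where S: "open S" "a0 \<in> S" "\<And>a. a \<in> S \<Longrightarrow> ?t a \<in> V"
      by (rule eu_near_open[OF n chart_open[OF is_chartV]]) (use t0 chart_at_one in auto)
    have "((\<lambda>a. H (point a \<otimes> (point a0 \<otimes> p))) has_derivative (\<lambda>u. 0)) (at (\<phi> (?t a0)))"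
      using H[of "point a0 \<otimes> p"] c0 p t0 by simp
    from has_derivative_compose[OF smooth_germ_has_derivative[OF g] this]
    have "((\<lambda>a. H (point (\<phi> (?t a)) \<otimes> (point a0 \<otimes> p))) has_derivative (\<lambda>u. 0)) (at a0)" .
    then show ?thesis
    proof (rule has_derivative_transform_within_open[of _ _ _ _ "S \<inter> \<phi> ` V"])
      fix a assume a: "a \<in> S \<inter> \<phi> ` V"
      then have "point a \<in> carrier G" using point_carrier by blast
      moreover have "point (\<phi> (?t a)) = ?t a" using a S point_\<phi> by blast
      moreover have "?t a \<otimes> (point a0 \<otimes> p) = point a \<otimes> p"
        using c0 p \<open>point a \<in> carrier G\<close> by (simp add: m_assoc) (simp add: m_assoc[symmetric])
      ultimately show "H (point (\<phi> (?t a)) \<otimes> (point a0 \<otimes> p)) = H (point a \<otimes> p)" by simp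
    qed (use S open_\<phi>V a0 in auto)
  qed
  have const: "H (point a \<otimes> p) = H p" if p: "p \<in> carrier G" and a: "a \<in> ball origin r" for p a
  proof -
    have "((\<lambda>a. H (point a \<otimes> p)) has_derivative (\<lambda>u. 0)) (at a0 within ball origin r)"
      if "a0 \<in> ball origin r" for a0
      by (rule has_derivative_at_withinI[OF D[OF p]]) (use that r in blast)
    from has_derivative_zero_constant[OF convex_ball this]
    obtain c where c: "\<And>a. a \<in> ball origin r \<Longrightarrow> H (point a \<otimes> p) = c" by auto
    show ?thesis using c[OF a] c[of origin] r p by simp
  qed
  let ?S = "{g \<in> carrier G. \<forall>p\<in>carrier G. H (g \<otimes> p) = H p}"
  have "subgroup ?S G"
  proof (rule subgroupI)
    have "\<one> \<in> ?S" by simp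
    then show "?S \<noteq> {}" by blast
    fix a assume a: "a \<in> ?S"
    have "H (inv a \<otimes> p) = H p" if "p \<in> carrier G" for p
    proof -
      have "H (a \<otimes> (inv a \<otimes> p)) = H (inv a \<otimes> p)" using a that by simp
      then show ?thesis using a that by (simp add: m_assoc[symmetric])
    qed
    then show "inv a \<in> ?S" using a by simp
    fix b assume "b \<in> ?S"
    then show "a \<otimes> b \<in> ?S" using a by (simp add: m_assoc)
  qed auto
  moreover have "{x \<in> V. \<phi> x \<in> ball origin r} \<subseteq> ?S"
    using const V_carrier by (fastforce simp: point_\<phi>)
  ultimately have "?S = carrier G"
    by (intro connected_open_subgroup[OF conn _ openin_point_ball[of r]]) (use r chart_at_one in auto)
  then have "x \<in> ?S" using x by simp
  then have "H (x \<otimes> \<one>) = H \<one>" by blast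
  then show ?thesis using x by simp
qed


section \<open>The second center of a group with a cyclic metric\<close>

text \<open>As its values are central, \<open>g \<mapsto> x \<otimes> g \<otimes> inv x \<otimes> inv g\<close> is a homomorphism. Its derivative, being zero at
  the unit, is then zero near the unit, so the map is trivial on a neighbourhood of the unit, which
  therefore lies in the centralizer of \<open>x\<close>.\<close>

lemma commutator_trivial_if_derivative_zero:
  assumes conn: "connected_space (space_of M)" and x: "x \<in> carrier G"
    and central: "\<And>g h. g \<in> carrier G \<Longrightarrow> h \<in> carrier G \<Longrightarrow>
      h \<otimes> (x \<otimes> g \<otimes> inv x \<otimes> inv g) = (x \<otimes> g \<otimes> inv x \<otimes> inv g) \<otimes> h"
    and D: "\<And>v. deriv_at (\<lambda>b. \<phi> (x \<otimes> point b \<otimes> inv x \<otimes> inv (point b))) origin v = 0"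
    and g: "g \<in> carrier G"
  shows "x \<otimes> g = g \<otimes> x"
proof -
  let ?c = "\<lambda>g. x \<otimes> g \<otimes> inv x \<otimes> inv g"
  have c_closed: "?c g \<in> carrier G" if "g \<in> carrier G" for g using that x by simp
  have c_mult: "?c (g \<otimes> h) = ?c g \<otimes> ?c h" if g: "g \<in> carrier G" and h: "h \<in> carrier G" for g h
  proof -
    have "?c (g \<otimes> h) = x \<otimes> g \<otimes> inv x \<otimes> (?c h \<otimes> inv g)"
      using g h x by (simp add: m_assoc inv_mult_group inv_solve_left)
    also have "?c h \<otimes> inv g = inv g \<otimes> ?c h" using central[of h "inv g"] g h by simp
    finally show ?thesis using g h x by (simp add: m_assoc)
  qed
  have c_eq: "?c g = \<one> \<longleftrightarrow> x \<otimes> g = g \<otimes> x" if "g \<in> carrier G" for g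
  proof -
    have "?c g = (x \<otimes> g) \<otimes> inv (g \<otimes> x)" using that x by (simp add: m_assoc inv_mult_group)
    then show ?thesis using that x by (metis inv_closed inv_equality inv_inv m_closed r_inv)
  qed
  let ?k = "\<lambda>b. \<phi> (?c (point b))"
  have nk: "smooth_near euclidean_manifold M a (\<lambda>b. ?c (point b))" if "a \<in> \<phi> ` V" for a
    using that x by (auto intro!: eu_near_intros)
  have co: "?c (point origin) = \<one>" using x by simp
  have gk: "smooth_germ origin ?k"
    by (rule eu_near_\<phi>[OF nk[OF origin_in]]) (use co chart_at_one in simp)
  obtain T where T: "open T" "origin \<in> T" "\<And>b. b \<in> T \<Longrightarrow> ?c (point b) \<in> V"
    by (rule eu_near_open[OF nk[OF origin_in] chart_open[OF is_chartV]]) (use co chart_at_one in auto)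
  then obtain r where r: "r > 0" "ball origin r \<subseteq> T \<inter> \<phi> ` V"
    using open_contains_ball[of "T \<inter> \<phi> ` V"] open_\<phi>V origin_in by blast
  have Dk: "(?k has_derivative (\<lambda>u. 0)) (at a0)" if a0: "a0 \<in> T" "a0 \<in> \<phi> ` V" for a0
  proof -
    have p0: "point a0 \<in> carrier G" using point_carrier a0 by blast
    \<comment> \<open>near \<open>a0\<close> the map \<open>?k\<close> is \<open>?k\<close> near the origin, between two translations\<close>
    let ?t = "\<lambda>a. inv (point a0) \<otimes> point a"
    have nt: "smooth_near euclidean_manifold M a0 ?t" using a0 p0 by (auto intro!: eu_near_intros)
    have t0: "?t a0 = \<one>" using p0 by simp
    have gt: "smooth_germ a0 (\<lambda>a. \<phi> (?t a))" by (rule eu_near_\<phi>[OF nt]) (use t0 chart_at_one in simp)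
    obtain S where S: "open S" "a0 \<in> S" "\<And>a. a \<in> S \<Longrightarrow> ?t a \<in> V"
      by (rule eu_near_open[OF nt chart_open[OF is_chartV]]) (use t0 chart_at_one in auto)
    have nS': "smooth_near euclidean_manifold M a0 (\<lambda>a. ?c (?t a))"
      using a0 p0 x by (auto intro!: eu_near_intros)
    obtain S' where S': "open S'" "a0 \<in> S'" "\<And>a. a \<in> S' \<Longrightarrow> ?c (?t a) \<in> V"
      by (rule eu_near_open[OF nS' chart_open[OF is_chartV]]) (use t0 x chart_at_one in auto)
    let ?l = "\<lambda>y. \<phi> (?c (point a0) \<otimes> point y)"
    have gl: "smooth_germ origin ?l"
      by (rule eu_near_\<phi>) (use T(3)[OF a0(1)] c_closed[OF p0] origin_in in \<open>auto intro!: eu_near_intros\<close>)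
    have "(?k has_derivative (\<lambda>u. 0)) (at (\<phi> (?t a0)))"
      using smooth_germ_has_derivative[OF gk] D t0 by (simp add: has_derivative_def)
    then have "((\<lambda>a. ?k (\<phi> (?t a))) has_derivative (\<lambda>u. 0)) (at a0)"
      by (rule has_derivative_compose[OF smooth_germ_has_derivative[OF gt]])
    moreover have "(?l has_derivative deriv_at ?l origin) (at (?k (\<phi> (?t a0))))"
      using smooth_germ_has_derivative[OF gl] t0 co by simp
    ultimately have "((\<lambda>a. ?l (?k (\<phi> (?t a)))) has_derivative (\<lambda>u. deriv_at ?l origin 0)) (at a0)"
      by (rule has_derivative_compose)
    then have "((\<lambda>a. ?l (?k (\<phi> (?t a)))) has_derivative (\<lambda>u. 0)) (at a0)"
      by (simp add: linear_0[OF smooth_germ_linear_deriv[OF gl]])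
    then show ?thesis
    proof (rule has_derivative_transform_within_open[of _ _ _ _ "S \<inter> S' \<inter> \<phi> ` V"])
      fix a assume a: "a \<in> S \<inter> S' \<inter> \<phi> ` V"
      then have pa: "point a \<in> carrier G" using point_carrier by blast
      have "point (\<phi> (?t a)) = ?t a" "point (\<phi> (?c (?t a))) = ?c (?t a)"
        using a S(3)[of a] S'(3)[of a] point_\<phi> by auto
      then have "?l (?k (\<phi> (?t a))) = \<phi> (?c (point a0) \<otimes> ?c (?t a))" by simp
      also have "?c (point a0) \<otimes> ?c (?t a) = ?c (point a0 \<otimes> ?t a)"
        using c_mult[OF p0, of "?t a"] p0 pa by simp
      also have "point a0 \<otimes> ?t a = point a" using p0 pa by (simp add: m_assoc[symmetric])
      finally show "?l (?k (\<phi> (?t a))) = ?k a" .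
    qed (use S S' open_\<phi>V a0 in auto)
  qed
  have c_one: "?c (point a) = \<one>" if a: "a \<in> ball origin r" for a
  proof -
    have "(?k has_derivative (\<lambda>u. 0)) (at a0 within ball origin r)" if "a0 \<in> ball origin r" for a0
      by (rule has_derivative_at_withinI[OF Dk]) (use that r in blast)+
    from has_derivative_zero_constant[OF convex_ball this]
    obtain c where c: "\<And>a. a \<in> ball origin r \<Longrightarrow> ?k a = c" by auto
    have "?k a = origin" using c[OF a] c[of origin] r co by simp
    moreover have "?c (point a) \<in> V" using a r T(3) by blast
    ultimately show ?thesis using point_\<phi>[of "?c (point a)"] by simp
  qed
  let ?S = "{g \<in> carrier G. x \<otimes> g = g \<otimes> x}"
  have "subgroup ?S G"
  proof (rule subgroupI)
    have "\<one> \<in> ?S" using x by simp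
    then show "?S \<noteq> {}" by blast
    fix a assume a: "a \<in> ?S"
    then have aG: "a \<in> carrier G" and ax: "x \<otimes> a = a \<otimes> x" by auto
    have "x \<otimes> inv a = inv a \<otimes> (a \<otimes> x) \<otimes> inv a"
      using aG x by (simp only: m_assoc[symmetric] inv_closed m_closed l_inv l_one)
    also have "\<dots> = inv a \<otimes> (x \<otimes> a) \<otimes> inv a" by (simp only: ax)
    also have "\<dots> = inv a \<otimes> x"
      using aG x by (simp only: m_assoc inv_closed m_closed r_inv r_one)
    finally show "inv a \<in> ?S" using aG by simp
    fix b assume b: "b \<in> ?S"
    then have bG: "b \<in> carrier G" and bx: "x \<otimes> b = b \<otimes> x" by auto
    have "x \<otimes> (a \<otimes> b) = (a \<otimes> x) \<otimes> b" using aG bG x by (simp only: m_assoc[symmetric] ax)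
    also have "\<dots> = a \<otimes> (b \<otimes> x)" using aG bG x by (simp only: m_assoc bx)
    also have "\<dots> = a \<otimes> b \<otimes> x" using aG bG x by (simp only: m_assoc)
    finally show "a \<otimes> b \<in> ?S" using aG bG by simp
  qed auto
  moreover have "{y \<in> V. \<phi> y \<in> ball origin r} \<subseteq> ?S"
  proof
    fix y assume y: "y \<in> {y \<in> V. \<phi> y \<in> ball origin r}"
    then have "?c y = \<one>" using c_one[of "\<phi> y"] point_\<phi>[of y] by simp
    then show "y \<in> ?S" using y V_carrier[of y] c_eq[of y] by simp
  qed
  ultimately have "?S = carrier G"
    by (intro connected_open_subgroup[OF conn _ openin_point_ball[of r]]) (use r chart_at_one in auto)
  then show ?thesis using g by blast
qed

text \<open>The derivative at the unit of the commutator map \<open>g \<mapsto> x \<otimes> g \<otimes> inv x \<otimes> inv g\<close> in direction \<open>v\<close> is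
  \<open>w = Ad x v - v\<close>. It is the velocity of a curve of central elements, so its brackets vanish and
  cyclicity makes it orthogonal to all brackets. The derivative of \<open>z \<mapsto> \<langle>w, Ad z v\<rangle>\<close> is the inner
  product of \<open>w\<close> with a bracket; hence this function takes the same value at \<open>x\<close> and at the unit, and
  the difference of the two values is \<open>\<langle>w, w\<rangle>\<close>.\<close>

lemma central_if_commutators_central:
  assumes conn: "connected_space (space_of M)"
    and m: "riemannian_metric M m" and cyc: "cyclic_metric G M m"
    and x: "x \<in> carrier G"
    and central: "\<And>g h. g \<in> carrier G \<Longrightarrow> h \<in> carrier G \<Longrightarrow>
      h \<otimes> (x \<otimes> g \<otimes> inv x \<otimes> inv g) = (x \<otimes> g \<otimes> inv x \<otimes> inv g) \<otimes> h"
    and g: "g \<in> carrier G"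
  shows "x \<otimes> g = g \<otimes> x"
proof (rule commutator_trivial_if_derivative_zero[OF conn x central _ g])
  let ?c = "\<lambda>g. x \<otimes> g \<otimes> inv x \<otimes> inv g"
  let ?k = "\<lambda>b. \<phi> (?c (point b))"
  have nk: "smooth_near euclidean_manifold M origin (\<lambda>b. ?c (point b))"
    using origin_in x by (auto intro!: eu_near_intros)
  have ko: "?k origin = origin" using x by simp
  have gk: "smooth_germ origin ?k"
    by (rule eu_near_\<phi>[OF nk]) (use x chart_at_one in simp)
  obtain T where T: "open T" "origin \<in> T" "\<And>b. b \<in> T \<Longrightarrow> ?c (point b) \<in> V"
    by (rule eu_near_open[OF nk chart_open[OF is_chartV]]) (use x chart_at_one in auto)
  fix v
  define w where "w = deriv_at ?k origin v"
  have bracket_w: "lie_bracket u w = 0" "lie_bracket w u = 0" for u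
    unfolding w_def
    by (rule lie_bracket_central_velocity[OF gk ko, of "T \<inter> \<phi> ` V"];
        use T open_\<phi>V origin_in point_\<phi> central point_carrier in auto)+
  \<comment> \<open>the conjugate of \<open>point b\<close> by \<open>x\<close> is the product of a commutator and \<open>point b\<close>\<close>
  have Ad_x: "Ad x v = w + v"
  proof -
    have gi: "smooth_germ origin (\<lambda>b. b)" by (intro smooth_germ_linear bounded_linear_ident)
    have gp: "smooth_germ origin (\<lambda>b. (?k b, b))" by (intro smooth_germ_Pair gk gi)
    have gm: "smooth_germ origin (\<lambda>b. chart_mult (?k b, b))"
      by (rule smooth_germ_compose[OF gp]) (simp only: ko chart_mult_germ)
    have "deriv_at (\<lambda>b. \<phi> (x \<otimes> point b \<otimes> inv x)) origin = deriv_at (\<lambda>b. chart_mult (?k b, b)) origin" (is "?L = ?R")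
    proof (rule deriv_at_cong[OF gm, of "T \<inter> \<phi> ` V"])
      fix b assume b: "b \<in> T \<inter> \<phi> ` V"
      then have "point b \<in> carrier G" using point_carrier by blast
      then show "chart_mult (?k b, b) = \<phi> (x \<otimes> point b \<otimes> inv x)"
        using b x point_\<phi>[OF T(3)[of b]] by (simp add: chart_mult_def m_assoc)
    qed (use T open_\<phi>V origin_in in auto)
    then have "?L v = ?R v" by simp
    also have "\<dots> = deriv_at chart_mult (?k origin, origin) (deriv_at (\<lambda>b. (?k b, b)) origin v)"
      by (rule deriv_at_compose[OF gp]) (simp only: ko chart_mult_germ)
    also have "\<dots> = w + v"
      unfolding deriv_at_Pair[OF gk gi] ko deriv_chart_mult by (simp add: w_def)
    finally show ?thesis by (simp add: Ad_def)
  qed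
  have orth: "inner_at_one m w (lie_bracket u y) = 0" for u y
  proof -
    have "inner_at_one m (lie_bracket u y) w + inner_at_one m (lie_bracket y w) u
      + inner_at_one m (lie_bracket w u) y = 0"
      by (rule inner_at_one_cyclic[OF cyc])
    then show ?thesis
      using linear_0[OF inner_at_one_linear_right[OF m]]
      by (simp add: bracket_w inner_at_one_commute[OF m, of 0] inner_at_one_commute[OF m, of w])
  qed
  have "inner_at_one m w (Ad x v) = inner_at_one m w (Ad \<one> v)"
  proof (rule constant_if_derivative_zero[OF conn _ x, of "\<lambda>x. inner_at_one m w (Ad x v)"])
    fix p assume p: "p \<in> carrier G"
    have "bounded_linear (inner_at_one m w)"
      using inner_at_one_linear_right[OF m] by (simp add: linear_conv_bounded_linear)
    from bounded_linear.has_derivative[OF this Ad_has_derivative[of "Ad p v"]]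
    have "((\<lambda>a. inner_at_one m w (Ad (point a) (Ad p v))) has_derivative (\<lambda>u. 0)) (at origin)"
      by (simp add: orth)
    then show "((\<lambda>a. inner_at_one m w (Ad (point a \<otimes> p) v)) has_derivative (\<lambda>u. 0)) (at origin)"
      by (rule has_derivative_transform_within_open[OF _ open_\<phi>V origin_in])
        (simp add: Ad_mult[OF point_carrier p])
  qed
  then have "inner_at_one m w w = 0"
    by (simp add: Ad_x Ad_one linear_add[OF inner_at_one_linear_right[OF m]])
  then show "deriv_at ?k origin v = 0"
    using inner_at_one_pos[OF m, of w] w_def by fastforce
qed

end

section \<open>Nilpotent groups\<close>

lemma lower_central_series_subset:
  assumes "group G" shows "lower_central_series G n \<subseteq> carrier G"
proof (induction n)
  case (Suc n)
  interpret group G by fact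
  have "generate G {x \<otimes>\<^bsub>G\<^esub> y \<otimes>\<^bsub>G\<^esub> inv\<^bsub>G\<^esub> x \<otimes>\<^bsub>G\<^esub> inv\<^bsub>G\<^esub> y | x y.
        x \<in> carrier G \<and> y \<in> lower_central_series G n} \<subseteq> carrier G"
    by (rule generate_incl) (use Suc in auto)
  then show ?case by simp
qed simp

text \<open>The hypothesis says that the second center equals the center. If one term of the lower central
  series is central, the preceding term lies in the second center, so it is central too; going down
  the series one arrives at the whole group.\<close>

lemma comm_group_if_second_center_central:
  fixes G (structure)
  assumes "group G"
    and second_center: "\<And>x g. x \<in> carrier G \<Longrightarrow>
      (\<And>g h. g \<in> carrier G \<Longrightarrow> h \<in> carrier G \<Longrightarrow>
        h \<otimes> (x \<otimes> g \<otimes> inv x \<otimes> inv g) = (x \<otimes> g \<otimes> inv x \<otimes> inv g) \<otimes> h) \<Longrightarrow>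
      g \<in> carrier G \<Longrightarrow> x \<otimes> g = g \<otimes> x"
    and "\<And>z g. z \<in> lower_central_series G n \<Longrightarrow> g \<in> carrier G \<Longrightarrow> z \<otimes> g = g \<otimes> z"
  shows "comm_group G"
  using assms(3)
proof (induction n)
  case 0
  interpret group G by fact
  show ?case by (rule group_comm_groupI) (use 0 in simp)
next
  case (Suc n)
  interpret group G by fact
  show ?case
  proof (rule Suc.IH)
    fix z g assume z: "z \<in> lower_central_series G n" and g: "g \<in> carrier G"
    have zG: "z \<in> carrier G" using z lower_central_series_subset[OF assms(1)] by blast
    show "z \<otimes> g = g \<otimes> z"
    proof (rule second_center[OF zG _ g])
      fix g h assume g: "g \<in> carrier G" and h: "h \<in> carrier G"
      have "g \<otimes> z \<otimes> inv g \<otimes> inv z \<in> lower_central_series G (Suc n)"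
        unfolding lower_central_series.simps by (rule generate.incl) (use g z in blast)
      then have c: "g \<otimes> z \<otimes> inv g \<otimes> inv z \<otimes> inv h = inv h \<otimes> (g \<otimes> z \<otimes> inv g \<otimes> inv z)"
        by (rule Suc.prems) (use h in simp)
      \<comment> \<open>the commutators of the lower central series have the factors in the opposite order\<close>
      have e: "z \<otimes> g \<otimes> inv z \<otimes> inv g = inv (g \<otimes> z \<otimes> inv g \<otimes> inv z)"
        using g zG by (simp add: inv_mult_group m_assoc)
      show "h \<otimes> (z \<otimes> g \<otimes> inv z \<otimes> inv g) = (z \<otimes> g \<otimes> inv z \<otimes> inv g) \<otimes> h"
        using arg_cong[OF c, of "m_inv G"] g h zG unfolding e by (simp add: inv_mult_group[of _ "inv h"] inv_mult_group[of "inv h"])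
    qed
  qed
qed

theorem proposition5p5:
  fixes G :: "('a, 'm) monoid_scheme" and M :: "('a, 'e::euclidean_space) manifold"
  assumes "lie_group G M"
    and "connected_space (space_of M)"
    and "\<not> comm_group G"
    and "nilpotent_group G"
  shows "\<not> (\<exists>m. left_invariant_metric G M m \<and> cyclic_metric G M m)"
proof
  assume "\<exists>m. left_invariant_metric G M m \<and> cyclic_metric G M m"
  then obtain m where m: "riemannian_metric M m" "cyclic_metric G M m"
    by (auto simp: left_invariant_metric_def)
  have G: "group G" using assms(1) by (simp add: lie_group_def)
  interpret group G by fact
  have "smooth_atlas M" "\<one>\<^bsub>G\<^esub> \<in> topspace (space_of M)"
    using assms(1) by (auto simp: lie_group_def smooth_manifold_imp_smooth_atlas)
  then obtain V \<phi> where V: "(V, \<phi>) \<in> atlas M" "\<one>\<^bsub>G\<^esub> \<in> V"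
    by (rule smooth_atlas_cover)
  interpret charted_lie_group G M V \<phi>
    by unfold_locales (use assms(1) V in auto)
  obtain n where "lower_central_series G n = {\<one>\<^bsub>G\<^esub>}"
    using assms(4) by (auto simp: nilpotent_group_def)
  then have "z \<otimes>\<^bsub>G\<^esub> g = g \<otimes>\<^bsub>G\<^esub> z" if "z \<in> lower_central_series G n" "g \<in> carrier G" for z g
    using that by simp
  with comm_group_if_second_center_central[OF G central_if_commutators_central[OF assms(2) m]]
  have "comm_group G" by blast
  with assms(3) show False by contradiction
qed

end
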